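(* Let $(r_k)_{k\in\mathbb{Z}}$ be covariance coefficients with $\sum_{k\in\mathbb{Z}}|r_k|<\infty$ and $r_0\neq 0$, and let $R_T$, $V_T$, $\boldsymbol{\Upsilon}$ be defined from them as in the context. Let $N=N(T)$ be positive integers with $N/T\to c$ as $T\to\infty$, where $0<c<\infty$. Let $\widehat R^u_T$ be the $T\times T$ Toeplitz matrix with entries $[\widehat R^u_T]_{i,j}=\hat r^u_{j-i,T}$, $0\le i,j\le T-1$, where for $|k|\le T-1$ $$\hat{r}_{k,T}^u=\frac{1}{N(T-|k|)}\sum_{n=0}^{N-1}\sum_{t=0}^{T-1} v_{n,t+k}\,v_{n,t}^*\,\mathbf{1}_{0\le t+k\le T-1}.$$ Then, for any $x>0$, $$\mathbb{P}\left[\left\|\widehat R_T^u-R_T\right\|>x\right]\le \exp\left(-\frac{cTx^2}{4\|\boldsymbol{\Upsilon}\|_\infty^2\log T}\,(1+o(1))\right),$$ where $o(1)$ denotes a deterministic quantity, depending on $x$, that tends to $0$ as $T\to\infty$.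
   Context: $(r_k)_{k\in\mathbb{Z}}$ is a doubly infinite complex sequence of covariance coefficients: for every $T\ge 1$ the $T\times T$ Toeplitz matrix $R_T$ with entries $[R_T]_{i,j}=r_{j-i}$, $0\le i,j\le T-1$, is Hermitian nonnegative definite. For each $T$, $W_T$ is an $N\times T$ random matrix with independent $\mathcal{CN}(0,1)$ (standard circularly symmetric complex Gaussian) entries, and $V_T=[v_{n,t}]_{0\le n\le N-1,\,0\le t\le T-1}=W_TR_T^{1/2}$, where $R_T^{1/2}$ is any $T\times T$ matrix with $(R_T^{1/2})^{\mathsf H}R_T^{1/2}=R_T$; thus the rows of $V_T$ are independent and $\mathbb{E}[v_{n,t+k}v_{n,t}^*]=r_k$. Here $(\cdot)^*$ is complex conjugation and $(\cdot)^{\mathsf H}$ the Hermitian transpose. The function $\boldsymbol{\Upsilon}$ is $\boldsymbol{\Upsilon}(\lambda)=\sum_{k=-\infty}^{\infty}r_ke^{-\mathrm{i}k\lambda}$, $\lambda\in[0,2\pi)$, and $\|\boldsymbol{\Upsilon}\|_\infty$ is its sup norm. $\|\cdot\|$ applied to a matrix is the spectral norm. *)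

theory Defs
  imports "HOL-Probability.Probability" "Jordan_Normal_Form.Schur_Decomposition"
begin

definition l2_norm_vec :: "complex vec \<Rightarrow> real" where
  "l2_norm_vec v = sqrt (\<Sum>i<dim_vec v. (cmod (vec_index v i))\<^sup>2)"

text \<open>The supremum is over the closed unit ball, so that the index set is nonempty
  also for matrices without columns.\<close>

definition spectral_norm :: "complex mat \<Rightarrow> real" where
  "spectral_norm A =
     (SUP v\<in>{v \<in> carrier_vec (dim_col A). l2_norm_vec v \<le> 1}. l2_norm_vec (A *\<^sub>v v))"

definition hermitian_nonneg_definite :: "complex mat \<Rightarrow> bool" where
  "hermitian_nonneg_definite A \<longleftrightarrow>
     square_mat A \<and> mat_adjoint A = A \<and>
     (\<forall>v\<in>carrier_vec (dim_row A). 0 \<le> Re ((A *\<^sub>v v) \<bullet>c v))"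

definition toeplitz_mat :: "(int \<Rightarrow> complex) \<Rightarrow> nat \<Rightarrow> complex mat" where
  "toeplitz_mat a T = Matrix.mat T T (\<lambda>(i, j). a (int j - int i))"

definition covariance_coeffs :: "(int \<Rightarrow> complex) \<Rightarrow> bool" where
  "covariance_coeffs r \<longleftrightarrow> (\<forall>T\<ge>1. hermitian_nonneg_definite (toeplitz_mat r T))"

definition spectral_density :: "(int \<Rightarrow> complex) \<Rightarrow> real \<Rightarrow> complex" where
  "spectral_density r l =
     (\<Sum>\<^sub>\<infinity>k\<in>UNIV. r k * exp (- \<i> * of_int k * of_real l))"

definition sup_norm_2pi :: "(real \<Rightarrow> complex) \<Rightarrow> real" where
  "sup_norm_2pi f = (SUP l\<in>{0..<2 * pi}. cmod (f l))"

text \<open>The standard circularly symmetric complex Gaussian law: independent real and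
  imaginary parts, each centred normal with variance \<open>1/2\<close> (the second argument of
  \<^const>\<open>normal_density\<close> is the standard deviation).\<close>

definition standard_complex_gaussian :: "'a measure \<Rightarrow> ('a \<Rightarrow> complex) \<Rightarrow> bool" where
  "standard_complex_gaussian M Z \<longleftrightarrow>
     distributed M lborel (\<lambda>\<omega>. Re (Z \<omega>)) (normal_density 0 (sqrt (1 / 2))) \<and>
     distributed M lborel (\<lambda>\<omega>. Im (Z \<omega>)) (normal_density 0 (sqrt (1 / 2))) \<and>
     prob_space.indep_var M borel (\<lambda>\<omega>. Re (Z \<omega>)) borel (\<lambda>\<omega>. Im (Z \<omega>))"

definition iid_complex_gaussian_mat ::
    "'a measure \<Rightarrow> nat \<Rightarrow> nat \<Rightarrow> ('a \<Rightarrow> complex mat) \<Rightarrow> bool" where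
  "iid_complex_gaussian_mat M N T W \<longleftrightarrow>
     (\<forall>\<omega>\<in>space M. W \<omega> \<in> carrier_mat N T) \<and>
     (\<forall>n<N. \<forall>t<T. standard_complex_gaussian M (\<lambda>\<omega>. W \<omega> $$ (n, t))) \<and>
     prob_space.indep_vars M (\<lambda>_. borel) (\<lambda>(n, t) \<omega>. W \<omega> $$ (n, t)) ({..<N} \<times> {..<T})"

text \<open>Only meaningful for \<open>\<bar>k\<bar> < dim_col V\<close>; the indicator guards the conversion of the
  column index \<open>t + k\<close> to a natural number.\<close>

definition unbiased_autocov :: "complex mat \<Rightarrow> int \<Rightarrow> complex" where
  "unbiased_autocov V k =
     1 / (of_nat (dim_row V) * (of_nat (dim_col V) - of_int \<bar>k\<bar>)) *
     (\<Sum>n<dim_row V. \<Sum>t<dim_col V.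
        if 0 \<le> int t + k \<and> int t + k \<le> int (dim_col V) - 1
        then V $$ (n, nat (int t + k)) * cnj (V $$ (n, t)) else 0)"

definition unbiased_cov_estimate :: "complex mat \<Rightarrow> complex mat" where
  "unbiased_cov_estimate V = toeplitz_mat (unbiased_autocov V) (dim_col V)"

end

theory Submission
  imports Defs "HOL-Real_Asymp.Real_Asymp"
begin

text \<open>The error matrix is Toeplitz, hence a corner of a circulant matrix of size \<open>2 T\<close>, so its spectral
  norm is at most the maximum of the modulus of its symbol at \<open>2 T\<close> grid points. At each point the symbol
  is \<open>(1/N) \<Sum>\<^sub>n w\<^sub>n Q w\<^sub>n\<^sup>H - tr Q\<close> with \<open>w\<^sub>n\<close> the Gaussian rows of \<open>W\<close> and \<open>Q\<close> Hermitian of squared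
  Frobenius norm at most \<open>F\<^sup>2 = \<rho>\<^sup>2 \<Sum>\<^sub>k 1 / (T - \<bar>k\<bar>) \<sim> 2 \<rho>\<^sup>2 log T\<close>, where \<open>\<rho>\<close> is the sup norm of the
  density. The moment generating function of the form is the product of \<open>1 / (1 - \<sigma>)\<close> over the
  eigenvalues, and Chernoff's bound with parameter \<open>x / F\<^sup>2\<close> gives \<open>exp (- N x\<^sup>2 / (2 F\<^sup>2) (1 + o(1)))\<close>;
  the number \<open>4 T\<close> of events in the union bound is absorbed by the \<open>o(1)\<close>.\<close>

section \<open>Spectral decomposition of Hermitian matrices\<close>

text \<open>The obstacle is the extreme lags, which average few products: there the weight 1 / (T -
  |k|) is of order 1. The k-th diagonal has T - |k| entries of squared weight 1 / (T - |k|)^2 and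
  contributes 1 / (T - |k|) to the squared Frobenius norm of the weights; the two signs of k give
  twice a harmonic number, hence log T. Only Frobenius norms are estimated, and F also serves as the
  bound on the eigenvalues. This crude bound suffices because F tends to infinity while x is fixed:
  the parameter x / F^2, which minimises - t x + t^2 F^2 / 2 over t, scales every eigenvalue to size
  at most x / F. So 1 / (1 - \<sigma>) is exp (\<sigma> + \<sigma>^2 / 2) up to a factor 1 + o(1) on
  the quadratic term, and the linear terms add up to the subtracted trace. The centred form is real,
  so its modulus splits into two one-sided deviations; two signs at 2 T points make the 4 T events.
  Their cost ln (4 T) is negligible against T / log T.\<close>

lemma trace_mult_commute:
  fixes X Y :: "complex mat"
  assumes "X \<in> carrier_mat n n" "Y \<in> carrier_mat n n"
  shows "(\<Sum>i<n. (X * Y) $$ (i, i)) = (\<Sum>i<n. (Y * X) $$ (i, i))"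
proof -
  have "(X * Y) $$ (i, i) = (\<Sum>j<n. X $$ (i, j) * Y $$ (j, i))" if "i < n" for i
    using assms that by (auto simp: scalar_prod_def atLeast0LessThan)
  moreover have "(Y * X) $$ (i, i) = (\<Sum>j<n. X $$ (j, i) * Y $$ (i, j))" if "i < n" for i
    using assms that by (auto simp: scalar_prod_def atLeast0LessThan mult.commute)
  ultimately show ?thesis
    by (simp, subst sum.swap, simp)
qed

text \<open>If every root of the characteristic polynomial were \<open>c\<close>, the trace would be
  \<open>n * c\<close>: Schur's triangular form has the roots on its diagonal, and similarity
  preserves the trace.\<close>

lemma eigenvector_avoiding:
  fixes Q :: "nat \<Rightarrow> nat \<Rightarrow> complex"
  assumes "(\<Sum>i<n. Q i i) \<noteq> of_nat n * c"
  obtains v e where "\<exists>i<n. v i \<noteq> 0" "e \<noteq> c" "\<And>i. i < n \<Longrightarrow> (\<Sum>j<n. Q i j * v j) = e * v i"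
proof -
  define A where "A = Matrix.mat n n (\<lambda>(i, j). Q i j)"
  have A: "A \<in> carrier_mat n n" by (simp add: A_def)
  obtain es where es: "char_poly A = (\<Prod>a\<leftarrow>es. [:- a, 1:])" "length es = n"
    using char_poly_factorized[OF A] by blast
  obtain B P P' where "schur_decomposition A es = (B, P, P')"
    by (cases "schur_decomposition A es") auto
  from schur_decomposition[OF A es(1) this]
  have wit: "similar_mat_wit A B P P'" and diag: "diag_mat B = es" by auto
  note w = similar_mat_witD2[OF A wit]
  have "(\<Sum>i<n. Q i i) = (\<Sum>i<n. A $$ (i, i))"
    by (simp add: A_def)
  also have "\<dots> = (\<Sum>i<n. (P * (B * P')) $$ (i, i))"
    using w by (simp add: assoc_mult_mat[of P n n B n P' n])
  also have "\<dots> = (\<Sum>i<n. (B * P' * P) $$ (i, i))"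
    using w by (intro trace_mult_commute) auto
  also have "B * P' * P = B"
    using w by (simp add: assoc_mult_mat[of B n n P' n P n])
  also have "(\<Sum>i<n. B $$ (i, i)) = sum_list (diag_mat B)"
    using w by (simp add: diag_mat_def interv_sum_list_conv_sum_set_nat atLeast0LessThan)
  finally have tr: "(\<Sum>i<n. Q i i) = sum_list es"
    using diag by simp
  have "\<exists>e\<in>set es. e \<noteq> c"
  proof (rule ccontr)
    assume "\<not> ?thesis"
    then have "es = replicate n c"
      using es(2) by (intro replicate_eqI) auto
    then show False
      using tr assms by (simp add: sum_list_replicate)
  qed
  then obtain e where e: "e \<in> set es" "e \<noteq> c" by blast
  have "poly (char_poly A) e = 0"
    using e(1) unfolding es(1) by (induction es) auto
  then have "eigenvalue A e"
    using eigenvalue_root_char_poly[OF A] by blast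
  then obtain v where v: "v \<in> carrier_vec n" "v \<noteq> 0\<^sub>v n" "A *\<^sub>v v = e \<cdot>\<^sub>v v"
    using A by (auto simp: eigenvalue_def eigenvector_def)
  show ?thesis
  proof (rule that[of "\<lambda>i. vec_index v i" e])
    show "\<exists>i<n. vec_index v i \<noteq> 0"
      using v(1,2) by (metis carrier_vecD eq_vecI index_zero_vec)
    show "e \<noteq> c" by fact
    fix i assume i: "i < n"
    have "vec_index (A *\<^sub>v v) i = (\<Sum>j<n. Q i j * vec_index v j)"
      using i v(1) by (auto simp: A_def scalar_prod_def atLeast0LessThan)
    then show "(\<Sum>j<n. Q i j * vec_index v j) = e * vec_index v i"
      using v i by simp
  qed
qed

lemma hermitian_form_real:
  fixes Q :: "nat \<Rightarrow> nat \<Rightarrow> complex"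
  assumes "\<And>i j. i < n \<Longrightarrow> j < n \<Longrightarrow> Q j i = cnj (Q i j)"
  shows "cnj (\<Sum>i<n. \<Sum>j<n. cnj (v i) * Q i j * v j) = (\<Sum>i<n. \<Sum>j<n. cnj (v i) * Q i j * v j)"
proof -
  have "cnj (\<Sum>i<n. \<Sum>j<n. cnj (v i) * Q i j * v j) = (\<Sum>i<n. \<Sum>j<n. cnj (v j) * Q j i * v i)"
    by (simp add: assms[symmetric] mult_ac)
  also have "\<dots> = (\<Sum>i<n. \<Sum>j<n. cnj (v i) * Q i j * v j)"
    by (rule sum.swap)
  finally show ?thesis .
qed

text \<open>Replacing the eigenvalues of the orthonormal eigenvectors found so far by a common value
  \<open>c\<close> that is not the mean of the spectrum leaves an eigenvalue different from \<open>c\<close>; by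
  symmetry its eigenvectors are orthogonal to the old ones.\<close>

lemma hermitian_orthonormal_eigenvectors:
  fixes Q :: "nat \<Rightarrow> nat \<Rightarrow> complex"
  assumes herm: "\<And>i j. i < n \<Longrightarrow> j < n \<Longrightarrow> Q j i = cnj (Q i j)"
    and "k \<le> n"
  shows "\<exists>(s :: nat \<Rightarrow> real) u.
    (\<forall>l<k. \<forall>m<k. (\<Sum>i<n. u l i * cnj (u m i)) = (if l = m then 1 else 0)) \<and>
    (\<forall>l<k. \<forall>i<n. (\<Sum>j<n. Q i j * u l j) = of_real (s l) * u l i)"
  using \<open>k \<le> n\<close>
proof (induction k)
  case 0
  show ?case by simp
next
  case (Suc k)
  then obtain s :: "nat \<Rightarrow> real" and u where
    orth: "\<And>l m. l < k \<Longrightarrow> m < k \<Longrightarrow> (\<Sum>i<n. u l i * cnj (u m i)) = (if l = m then 1 else 0)"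
    and eig: "\<And>l i. l < k \<Longrightarrow> i < n \<Longrightarrow> (\<Sum>j<n. Q i j * u l j) = of_real (s l) * u l i"
    by fastforce
  have k: "k < n" using Suc by simp
  have herm': "cnj (Q j i) = Q i j" if "i < n" "j < n" for i j
    using herm[OF that] by simp
  define d where "d = (\<Sum>i<n. Q i i) - (\<Sum>l<k. of_real (s l))"
  \<comment> \<open>The deflated matrix \<open>Q'\<close> has trace \<open>d + k * c\<close>, which
    must differ from \<open>n * c\<close>. As \<open>k < n\<close>, the value 1 works when
    \<open>d = 0\<close>, and 0 works otherwise.\<close>
  define c :: complex where "c = (if d = 0 then 1 else 0)"
  define Q' where "Q' i j = Q i j + (\<Sum>l<k. (c - of_real (s l)) * u l i * cnj (u l j))" for i j
  have "(\<Sum>i<n. Q' i i) = (\<Sum>i<n. Q i i) + (\<Sum>i<n. \<Sum>l<k. (c - of_real (s l)) * u l i * cnj (u l i))"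
    by (simp add: Q'_def sum.distrib)
  also have "(\<Sum>i<n. \<Sum>l<k. (c - of_real (s l)) * u l i * cnj (u l i))
      = (\<Sum>l<k. (c - of_real (s l)) * (\<Sum>i<n. u l i * cnj (u l i)))"
    by (subst sum.swap) (simp add: sum_distrib_left mult_ac)
  also have "\<dots> = (\<Sum>l<k. c - of_real (s l))"
    by (intro sum.cong) (auto simp: orth)
  finally have "(\<Sum>i<n. Q' i i) = d + of_nat k * c"
    by (simp add: d_def sum_subtractf)
  moreover have "d + of_nat k * c \<noteq> of_nat n * c"
    using k by (auto simp: c_def)
  ultimately have "(\<Sum>i<n. Q' i i) \<noteq> of_nat n * c" by simp
  then obtain v e where v: "\<exists>i<n. v i \<noteq> 0" and e: "e \<noteq> c"
    and ev: "\<And>i. i < n \<Longrightarrow> (\<Sum>j<n. Q' i j * v j) = e * v i"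
    using eigenvector_avoiding[of Q' n c] by blast
  define \<alpha> where "\<alpha> l = (\<Sum>j<n. cnj (u l j) * v j)" for l
  have Q'v: "(\<Sum>j<n. Q' i j * v j) = (\<Sum>j<n. Q i j * v j) + (\<Sum>l<k. (c - of_real (s l)) * u l i * \<alpha> l)" for i
  proof -
    have "(\<Sum>j<n. Q' i j * v j) = (\<Sum>j<n. Q i j * v j)
        + (\<Sum>j<n. \<Sum>l<k. (c - of_real (s l)) * u l i * cnj (u l j) * v j)"
      by (simp add: Q'_def sum.distrib distrib_right sum_distrib_right)
    also have "(\<Sum>j<n. \<Sum>l<k. (c - of_real (s l)) * u l i * cnj (u l j) * v j)
        = (\<Sum>l<k. (c - of_real (s l)) * u l i * \<alpha> l)"
      by (subst sum.swap) (simp add: \<alpha>_def sum_distrib_left mult_ac)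
    finally show ?thesis .
  qed
  \<comment> \<open>Pairing the eigenvector equation of \<open>Q'\<close> with \<open>u l\<close>:
    symmetry of \<open>Q\<close> yields \<open>s l * \<alpha> l\<close> and the correction adds
    \<open>(c - s l) * \<alpha> l\<close>, so
    \<open>e * \<alpha> l = c * \<alpha> l\<close>.\<close>
  have \<alpha>0: "\<alpha> l = 0" if l: "l < k" for l
  proof -
    have "e * \<alpha> l = (\<Sum>i<n. cnj (u l i) * (\<Sum>j<n. Q' i j * v j))"
      by (simp add: ev) (simp add: \<alpha>_def sum_distrib_left mult_ac)
    also have "\<dots> = (\<Sum>i<n. cnj (u l i) * (\<Sum>j<n. Q i j * v j))
        + (\<Sum>i<n. \<Sum>m<k. (c - of_real (s m)) * \<alpha> m * (u m i * cnj (u l i)))"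
      by (simp add: Q'v distrib_left sum.distrib) (simp add: sum_distrib_left mult_ac)
    also have "(\<Sum>i<n. \<Sum>m<k. (c - of_real (s m)) * \<alpha> m * (u m i * cnj (u l i)))
        = (\<Sum>m<k. (c - of_real (s m)) * \<alpha> m * (\<Sum>i<n. u m i * cnj (u l i)))"
      by (subst sum.swap) (simp add: sum_distrib_left)
    also have "\<dots> = (\<Sum>m<k. if m = l then (c - of_real (s m)) * \<alpha> m else 0)"
      using l by (intro sum.cong) (auto simp: orth)
    also have "\<dots> = (c - of_real (s l)) * \<alpha> l"
      using l by simp
    also have "(\<Sum>i<n. cnj (u l i) * (\<Sum>j<n. Q i j * v j))
        = (\<Sum>j<n. cnj (\<Sum>i<n. Q j i * u l i) * v j)"
      unfolding sum_distrib_left cnj_sum sum_distrib_right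
      by (subst sum.swap) (auto intro!: sum.cong simp: herm' mult_ac)
    also have "\<dots> = of_real (s l) * \<alpha> l"
      using l by (simp add: eig) (simp add: \<alpha>_def sum_distrib_left mult_ac)
    finally have "(e - c) * \<alpha> l = 0"
      by (simp add: algebra_simps)
    then show ?thesis using e by simp
  qed
  have Qv: "(\<Sum>j<n. Q i j * v j) = e * v i" if "i < n" for i
    using Q'v[of i] ev[OF that] by (simp add: \<alpha>0)
  define q where "q = (\<Sum>i<n. (cmod (v i))\<^sup>2)"
  have q: "q > 0"
    using v unfolding q_def by (auto intro!: sum_pos2)
  have vv: "(\<Sum>i<n. v i * cnj (v i)) = of_real q"
    unfolding q_def of_real_sum by (intro sum.cong) (simp_all only: complex_norm_square)
  \<comment> \<open>The eigenvalue is real, being the quotient of a real Hermitian form by the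
    squared norm \<open>q\<close>.\<close>
  have "(\<Sum>i<n. \<Sum>j<n. cnj (v i) * Q i j * v j) = (\<Sum>i<n. cnj (v i) * (\<Sum>j<n. Q i j * v j))"
    by (simp add: sum_distrib_left mult_ac)
  also have "\<dots> = (\<Sum>i<n. cnj (v i) * (e * v i))"
    by (simp add: Qv)
  also have "\<dots> = e * of_real q"
    unfolding vv[symmetric] by (simp add: sum_distrib_left mult_ac)
  finally have "cnj (e * of_real q) = e * of_real q"
    using hermitian_form_real[of n Q v, OF herm] by simp
  then have "cnj e = e" using q by simp
  then have er: "of_real (Re e) = e"
    by (metis Reals_cnj_iff of_real_Re)
  define w where "w i = v i / of_real (sqrt q)" for i
  have "(\<Sum>i<n. w i * cnj (w i)) = (\<Sum>i<n. v i * cnj (v i)) / (of_real (sqrt q) * of_real (sqrt q))"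
    by (simp add: w_def sum_divide_distrib)
  also have "of_real (sqrt q) * of_real (sqrt q) = complex_of_real q"
    using q by (simp flip: of_real_mult)
  finally have ww: "(\<Sum>i<n. w i * cnj (w i)) = 1"
    using q by (simp add: vv)
  have uw: "(\<Sum>i<n. w i * cnj (u l i)) = 0" if "l < k" for l
    using \<alpha>0[OF that] by (simp add: w_def \<alpha>_def mult_ac flip: sum_divide_distrib)
  have wu: "(\<Sum>i<n. u l i * cnj (w i)) = 0" if "l < k" for l
    using arg_cong[OF uw[OF that], of cnj] by (simp add: mult_ac)
  have Qw: "(\<Sum>j<n. Q i j * w j) = e * w i" if "i < n" for i
    using Qv[OF that] by (simp add: w_def flip: sum_divide_distrib)
  show ?case
    using orth eig ww uw wu Qw er
    by (intro exI[of _ "s(k := Re e)"] exI[of _ "u(k := w)"]) (auto simp: less_Suc_eq)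
qed

text \<open>The n orthonormal eigenvectors form a square matrix, so its one-sided inverse is
  two-sided. That is the completeness relation, and inserting it as an identity after
  \<open>Q\<close> gives the expansion.\<close>

lemma hermitian_spectral_decomposition:
  fixes Q :: "nat \<Rightarrow> nat \<Rightarrow> complex"
  assumes herm: "\<And>i j. i < n \<Longrightarrow> j < n \<Longrightarrow> Q j i = cnj (Q i j)"
  obtains s :: "nat \<Rightarrow> real" and u :: "nat \<Rightarrow> nat \<Rightarrow> complex" where
    "\<And>k l. k < n \<Longrightarrow> l < n \<Longrightarrow> (\<Sum>i<n. u k i * cnj (u l i)) = (if k = l then 1 else 0)"
    "\<And>i j. i < n \<Longrightarrow> j < n \<Longrightarrow> (\<Sum>k<n. u k i * cnj (u k j)) = (if i = j then 1 else 0)"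
    "\<And>i j. i < n \<Longrightarrow> j < n \<Longrightarrow> Q i j = (\<Sum>k<n. of_real (s k) * u k i * cnj (u k j))"
proof -
  obtain s :: "nat \<Rightarrow> real" and u where
    orth: "\<And>l m. l < n \<Longrightarrow> m < n \<Longrightarrow> (\<Sum>i<n. u l i * cnj (u m i)) = (if l = m then 1 else 0)"
    and eig: "\<And>l i. l < n \<Longrightarrow> i < n \<Longrightarrow> (\<Sum>j<n. Q i j * u l j) = of_real (s l) * u l i"
    using hermitian_orthonormal_eigenvectors[of n Q n, OF herm order.refl] by blast
  define U where "U = Matrix.mat n n (\<lambda>(k, i). u k i)"
  define U' where "U' = Matrix.mat n n (\<lambda>(i, k). cnj (u k i))"
  have "U * U' = 1\<^sub>m n"
    by (rule eq_matI) (auto simp: U_def U'_def scalar_prod_def atLeast0LessThan orth)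
  then have UU: "U' * U = 1\<^sub>m n"
    by (rule mat_mult_left_right_inverse[rotated 2]) (auto simp: U_def U'_def)
  have compl: "(\<Sum>k<n. u k i * cnj (u k j)) = (if i = j then 1 else 0)" if "i < n" "j < n" for i j
  proof -
    have "(\<Sum>k<n. u k i * cnj (u k j)) = (U' * U) $$ (j, i)"
      using that by (simp add: U_def U'_def scalar_prod_def atLeast0LessThan mult.commute)
    then show ?thesis
      using that by (auto simp: UU)
  qed
  have "Q i j = (\<Sum>k<n. of_real (s k) * u k i * cnj (u k j))" if "i < n" "j < n" for i j
  proof -
    have "(\<Sum>k<n. of_real (s k) * u k i * cnj (u k j)) = (\<Sum>k<n. (\<Sum>l<n. Q i l * u k l) * cnj (u k j))"
      using that by (simp add: eig)
    also have "\<dots> = (\<Sum>l<n. Q i l * (\<Sum>k<n. u k l * cnj (u k j)))"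
      unfolding sum_distrib_left sum_distrib_right by (subst sum.swap) (simp add: mult_ac)
    also have "\<dots> = (\<Sum>l<n. if l = j then Q i l else 0)"
      using that by (intro sum.cong) (auto simp: compl)
    finally show ?thesis using that by simp
  qed
  with orth compl show ?thesis by (rule that)
qed

section \<open>Quadratic forms in complex Gaussian variables\<close>

text \<open>Completing the square: density times integrand is a constant times the normal density
  with mean \<open>a / (1 + m)\<close> and variance \<open>1 / (2 * (1 + m))\<close>, which is
  positive since \<open>m > -1\<close>. Linear tilt and quadratic weight are treated together
  because the linearisation needs both.\<close>

lemma nn_integral_normal_exp_quadratic:
  assumes X: "distributed M lborel X (normal_density 0 (sqrt (1 / 2)))" and m: "m > -1"
  shows "(\<integral>\<^sup>+\<omega>. ennreal (exp (2 * a * X \<omega> - m * (X \<omega>)\<^sup>2)) \<partial>M)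
       = ennreal (exp (a\<^sup>2 / (1 + m)) / sqrt (1 + m))"
proof -
  define b where "b = sqrt (1 / (2 * (1 + m)))"
  define C where "C = exp (a\<^sup>2 / (1 + m)) / sqrt (1 + m)"
  have b2: "b\<^sup>2 = 1 / (2 * (1 + m))"
    using m by (simp add: b_def)
  have C: "C \<ge> 0" using m by (simp add: C_def)
  have eq: "normal_density 0 (sqrt (1 / 2)) x * exp (2 * a * x - m * x\<^sup>2)
      = C * normal_density (a / (1 + m)) b x" for x
  proof -
    have "- x\<^sup>2 + (2 * a * x - m * x\<^sup>2) = a\<^sup>2 / (1 + m) + - ((x - a / (1 + m))\<^sup>2 * (1 + m))"
    proof -
      define t where "t = a / (1 + m)"
      have a: "a = t * (1 + m)" "a\<^sup>2 / (1 + m) = t\<^sup>2 * (1 + m)"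
        using m by (simp_all add: t_def power2_eq_square)
      show ?thesis
        unfolding a(2) t_def[symmetric] unfolding a(1) by (simp add: power2_eq_square algebra_simps)
    qed
    then have "exp (- x\<^sup>2) * exp (2 * a * x - m * x\<^sup>2)
        = exp (a\<^sup>2 / (1 + m)) * exp (- ((x - a / (1 + m))\<^sup>2 * (1 + m)))"
      by (simp only: exp_add[symmetric])
    moreover have "normal_density 0 (sqrt (1 / 2)) x = exp (- x\<^sup>2) / sqrt pi"
      by (simp add: normal_density_def power_divide)
    moreover have "normal_density (a / (1 + m)) b x
        = sqrt (1 + m) * exp (- ((x - a / (1 + m))\<^sup>2 * (1 + m))) / sqrt pi"
    proof -
      have "2 * pi * b\<^sup>2 = pi / (1 + m)" and "- (x - a / (1 + m))\<^sup>2 / (2 * b\<^sup>2) = - ((x - a / (1 + m))\<^sup>2 * (1 + m))"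
        using m by (simp_all add: b2 divide_simps)
      then show ?thesis
        by (simp add: normal_density_def real_sqrt_divide)
    qed
    ultimately show ?thesis
      using m by (simp add: C_def)
  qed
  have "(\<integral>\<^sup>+\<omega>. ennreal (exp (2 * a * X \<omega> - m * (X \<omega>)\<^sup>2)) \<partial>M)
      = (\<integral>\<^sup>+x. ennreal (normal_density 0 (sqrt (1 / 2)) x) * ennreal (exp (2 * a * x - m * x\<^sup>2)) \<partial>lborel)"
    by (rule distributed_nn_integral[OF X, symmetric]) measurable
  also have "\<dots> = (\<integral>\<^sup>+x. ennreal C * ennreal (normal_density (a / (1 + m)) b x) \<partial>lborel)"
    by (simp add: ennreal_mult[symmetric] eq C)
  also have "\<dots> = ennreal C * (\<integral>\<^sup>+x. ennreal (normal_density (a / (1 + m)) b x) \<partial>lborel)"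
    by (rule nn_integral_cmult) measurable
  also have "(\<integral>\<^sup>+x. ennreal (normal_density (a / (1 + m)) b x) \<partial>lborel)
      = emeasure (density lborel (normal_density (a / (1 + m)) b)) (space lborel)"
    by (simp add: emeasure_density)
  also have "\<dots> = 1"
  proof -
    have "b > 0" using m by (simp add: b_def)
    then interpret D: prob_space "density lborel (normal_density (a / (1 + m)) b)"
      by (rule prob_space_normal_density)
    show ?thesis using D.emeasure_space_1 by simp
  qed
  finally show ?thesis by (simp add: C_def)
qed

lemma nn_integral_complex_gaussian_exp_quadratic:
  assumes "prob_space M" and Z: "standard_complex_gaussian M Z" and m: "m > -1"
  shows "(\<integral>\<^sup>+\<omega>. ennreal (exp (2 * Re (cnj a * Z \<omega>) - m * (cmod (Z \<omega>))\<^sup>2)) \<partial>M)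
       = ennreal (exp ((cmod a)\<^sup>2 / (1 + m)) / (1 + m))"
proof -
  interpret prob_space M by fact
  \<comment> \<open>\<open>indep_var\<close> is independence of a family indexed by
    \<open>bool\<close>; indexing the two factors the same way makes the product formula
    applicable.\<close>
  define F where "F b \<omega> = (case b of
      True \<Rightarrow> ennreal (exp (2 * Re a * Re (Z \<omega>) - m * (Re (Z \<omega>))\<^sup>2))
    | False \<Rightarrow> ennreal (exp (2 * Im a * Im (Z \<omega>) - m * (Im (Z \<omega>))\<^sup>2)))" for b \<omega>
  have re: "distributed M lborel (\<lambda>\<omega>. Re (Z \<omega>)) (normal_density 0 (sqrt (1 / 2)))"
    and im: "distributed M lborel (\<lambda>\<omega>. Im (Z \<omega>)) (normal_density 0 (sqrt (1 / 2)))"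
    and ind: "indep_var borel (\<lambda>\<omega>. Re (Z \<omega>)) borel (\<lambda>\<omega>. Im (Z \<omega>))"
    using Z by (auto simp: standard_complex_gaussian_def)
  have "indep_var borel (F True) borel (F False)"
    using indep_var_compose[OF ind,
        of "\<lambda>x. ennreal (exp (2 * Re a * x - m * x\<^sup>2))" borel
           "\<lambda>x. ennreal (exp (2 * Im a * x - m * x\<^sup>2))" borel]
    by (simp add: comp_def F_def[abs_def])
  then have indF: "indep_vars (\<lambda>_. borel) F UNIV"
    unfolding indep_var_def
    by (rule indep_vars_cong[THEN iffD1, rotated 3]) (auto split: bool.split)
  have "(\<integral>\<^sup>+\<omega>. ennreal (exp (2 * Re (cnj a * Z \<omega>) - m * (cmod (Z \<omega>))\<^sup>2)) \<partial>M)
      = (\<integral>\<^sup>+\<omega>. (\<Prod>b\<in>UNIV. F b \<omega>) \<partial>M)"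
    by (intro nn_integral_cong)
      (simp add: UNIV_bool F_def ennreal_mult[symmetric] exp_add[symmetric] cmod_power2 algebra_simps)
  also have "\<dots> = (\<Prod>b\<in>UNIV. \<integral>\<^sup>+\<omega>. F b \<omega> \<partial>M)"
    by (rule indep_vars_nn_integral[OF _ indF]) auto
  also have "\<dots> = ennreal (exp ((Im a)\<^sup>2 / (1 + m)) / sqrt (1 + m)) * ennreal (exp ((Re a)\<^sup>2 / (1 + m)) / sqrt (1 + m))"
    by (simp add: UNIV_bool F_def nn_integral_normal_exp_quadratic[OF re m]
        nn_integral_normal_exp_quadratic[OF im m])
  also have "\<dots> = ennreal (exp ((cmod a)\<^sup>2 / (1 + m)) / (1 + m))"
    using m by (simp add: ennreal_mult[symmetric] exp_add[symmetric] cmod_power2 add_divide_distrib)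
  finally show ?thesis .
qed

text \<open>Linearisation: each factor \<open>exp (\<rho> \<bar>y\<bar>\<^sup>2)\<close> is the exponential moment
  \<open>E\<^sub>g exp (2 Re (cnj (sqrt \<rho> y) g))\<close> of a Gaussian \<open>g\<close> on a second copy of the space, after which
  Fubini makes the original variables appear linearly. This replaces the unitary invariance of
  the Gaussian law. The weight \<open>exp (-m \<Sum>\<bar>Z\<bar>\<^sup>2)\<close> makes room for negative eigenvalues, as only
  \<open>\<rho> \<ge> 0\<close> can be linearised.\<close>

lemma nn_integral_complex_gaussian_exp_form:
  fixes Z :: "'i \<Rightarrow> 'a \<Rightarrow> complex" and u :: "'i \<Rightarrow> 'i \<Rightarrow> complex" and \<rho> :: "'i \<Rightarrow> real"
  assumes "prob_space M" and I: "finite I"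
    and ind: "prob_space.indep_vars M (\<lambda>_. borel) Z I"
    and Z: "\<And>i. i \<in> I \<Longrightarrow> standard_complex_gaussian M (Z i)"
    and orth: "\<And>j k. j \<in> I \<Longrightarrow> k \<in> I \<Longrightarrow> (\<Sum>i\<in>I. u j i * cnj (u k i)) = (if j = k then 1 else 0)"
    and m: "m > -1" and \<rho>: "\<And>j. j \<in> I \<Longrightarrow> 0 \<le> \<rho> j \<and> \<rho> j < 1 + m"
  shows "(\<integral>\<^sup>+\<omega>. ennreal (exp ((\<Sum>j\<in>I. \<rho> j * (cmod (\<Sum>i\<in>I. u j i * Z i \<omega>))\<^sup>2)
            - m * (\<Sum>i\<in>I. (cmod (Z i \<omega>))\<^sup>2))) \<partial>M)
       = ennreal (\<Prod>j\<in>I. 1 / (1 + m - \<rho> j))"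
proof -
  interpret prob_space M by fact
  interpret P: pair_sigma_finite M M by unfold_locales
  define y where "y j \<omega> = (\<Sum>i\<in>I. u j i * Z i \<omega>)" for j \<omega>
  define b where "b i \<omega> = (\<Sum>j\<in>I. of_real (sqrt (\<rho> j)) * cnj (u j i) * Z j \<omega>)" for i \<omega>
  \<comment> \<open>Here \<omega> is the original sample and \<omega>' the auxiliary copy.
    Integrating out \<omega>' restores the quadratic form; integrating out \<omega> first gives the
    value. \<open>b i\<close> collects the coefficient of \<open>Z i \<omega>\<close> in the
    exponent.\<close>
  define G where "G \<omega> \<omega>' = exp ((\<Sum>j\<in>I. 2 * Re (cnj (of_real (sqrt (\<rho> j)) * y j \<omega>) * Z j \<omega>'))
      - m * (\<Sum>i\<in>I. (cmod (Z i \<omega>))\<^sup>2))" for \<omega> \<omega>'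
  have [measurable]: "i \<in> I \<Longrightarrow> Z i \<in> borel_measurable M" for i
    using ind unfolding indep_vars_def by auto
  have [measurable]: "y j \<in> borel_measurable M" for j
    unfolding y_def[abs_def] by measurable
  have indep: "indep_vars (\<lambda>_. borel) (\<lambda>i \<omega>. ennreal (exp (2 * Re (cnj (a i) * Z i \<omega>) - d i * (cmod (Z i \<omega>))\<^sup>2))) I" for a d
    by (rule indep_vars_compose2[OF ind]) measurable
  \<comment> \<open>Used three times: \<open>d = 0\<close> for the linearisation,
    \<open>d = m\<close> for the original variables, and \<open>d = - \<rho> / (1 + m)\<close> for
    the copy.\<close>
  have prod: "(\<integral>\<^sup>+\<omega>. ennreal (exp (\<Sum>i\<in>I. 2 * Re (cnj (a i) * Z i \<omega>) - d i * (cmod (Z i \<omega>))\<^sup>2)) \<partial>M)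
      = ennreal (\<Prod>i\<in>I. exp ((cmod (a i))\<^sup>2 / (1 + d i)) / (1 + d i))"
    if d: "\<And>i. i \<in> I \<Longrightarrow> d i > -1" for a d
  proof -
    have "(\<integral>\<^sup>+\<omega>. ennreal (exp (\<Sum>i\<in>I. 2 * Re (cnj (a i) * Z i \<omega>) - d i * (cmod (Z i \<omega>))\<^sup>2)) \<partial>M)
        = (\<integral>\<^sup>+\<omega>. (\<Prod>i\<in>I. ennreal (exp (2 * Re (cnj (a i) * Z i \<omega>) - d i * (cmod (Z i \<omega>))\<^sup>2))) \<partial>M)"
      by (simp only: exp_sum[OF I] prod_ennreal exp_ge_zero)
    also have "\<dots> = (\<Prod>i\<in>I. \<integral>\<^sup>+\<omega>. ennreal (exp (2 * Re (cnj (a i) * Z i \<omega>) - d i * (cmod (Z i \<omega>))\<^sup>2)) \<partial>M)"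
      by (rule indep_vars_nn_integral[OF I indep]) auto
    also have "\<dots> = (\<Prod>i\<in>I. ennreal (exp ((cmod (a i))\<^sup>2 / (1 + d i)) / (1 + d i)))"
      using d Z assms(1) by (intro prod.cong refl nn_integral_complex_gaussian_exp_quadratic) auto
    also have "\<dots> = ennreal (\<Prod>i\<in>I. exp ((cmod (a i))\<^sup>2 / (1 + d i)) / (1 + d i))"
    proof (rule prod_ennreal)
      fix i assume "i \<in> I"
      then show "0 \<le> exp ((cmod (a i))\<^sup>2 / (1 + d i)) / (1 + d i)"
        using d[of i] by simp
    qed
    finally show ?thesis .
  qed
  have lin: "(\<integral>\<^sup>+\<omega>'. ennreal (G \<omega> \<omega>') \<partial>M)
      = ennreal (exp ((\<Sum>j\<in>I. \<rho> j * (cmod (y j \<omega>))\<^sup>2) - m * (\<Sum>i\<in>I. (cmod (Z i \<omega>))\<^sup>2)))" for \<omega>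
  proof -
    have "(\<integral>\<^sup>+\<omega>'. ennreal (G \<omega> \<omega>') \<partial>M) = (\<integral>\<^sup>+\<omega>'. ennreal (exp (- m * (\<Sum>i\<in>I. (cmod (Z i \<omega>))\<^sup>2)))
        * ennreal (exp (\<Sum>j\<in>I. 2 * Re (cnj (of_real (sqrt (\<rho> j)) * y j \<omega>) * Z j \<omega>') - 0 * (cmod (Z j \<omega>'))\<^sup>2)) \<partial>M)"
      by (intro nn_integral_cong) (simp add: G_def ennreal_mult[symmetric] exp_add[symmetric])
    also have "\<dots> = ennreal (exp (- m * (\<Sum>i\<in>I. (cmod (Z i \<omega>))\<^sup>2))) *
        ennreal (\<Prod>j\<in>I. exp ((cmod (of_real (sqrt (\<rho> j)) * y j \<omega>))\<^sup>2 / (1 + 0)) / (1 + 0))"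
      by (subst nn_integral_cmult, measurable, subst prod) auto
    also have "(\<Prod>j\<in>I. exp ((cmod (of_real (sqrt (\<rho> j)) * y j \<omega>))\<^sup>2 / (1 + 0)) / (1 + 0))
        = exp (\<Sum>j\<in>I. \<rho> j * (cmod (y j \<omega>))\<^sup>2)"
      unfolding exp_sum[OF I] using \<rho> by (intro prod.cong) (auto simp: norm_mult power_mult_distrib)
    finally show ?thesis
      by (simp add: ennreal_mult[symmetric] exp_add[symmetric])
  qed
  have exponent: "(\<Sum>j\<in>I. 2 * Re (cnj (of_real (sqrt (\<rho> j)) * y j \<omega>) * Z j \<omega>'))
      = (\<Sum>i\<in>I. 2 * Re (cnj (b i \<omega>') * Z i \<omega>))" for \<omega> \<omega>'
  proof -
    have "(\<Sum>j\<in>I. cnj (of_real (sqrt (\<rho> j)) * y j \<omega>) * Z j \<omega>')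
        = (\<Sum>i\<in>I. cnj (cnj (b i \<omega>') * Z i \<omega>))"
      unfolding y_def b_def cnj_sum complex_cnj_mult sum_distrib_left sum_distrib_right
      by (subst sum.swap) (simp add: mult_ac)
    then have "Re (\<Sum>j\<in>I. cnj (of_real (sqrt (\<rho> j)) * y j \<omega>) * Z j \<omega>')
        = Re (\<Sum>i\<in>I. cnj (cnj (b i \<omega>') * Z i \<omega>))" by simp
    then show ?thesis
      unfolding Re_sum complex_cnj(1) by (simp only: sum_distrib_left[symmetric] cnj.sel)
  qed
  \<comment> \<open>Orthonormality enters here: the cross terms vanish, so the form left over in the
    copy is already diagonal.\<close>
  have normb: "(\<Sum>i\<in>I. (cmod (b i \<omega>))\<^sup>2) = (\<Sum>j\<in>I. \<rho> j * (cmod (Z j \<omega>))\<^sup>2)" for \<omega>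
  proof -
    have "complex_of_real (\<Sum>i\<in>I. (cmod (b i \<omega>))\<^sup>2) = (\<Sum>i\<in>I. b i \<omega> * cnj (b i \<omega>))"
      unfolding of_real_sum by (intro sum.cong) (simp_all only: complex_norm_square)
    also have "\<dots> = (\<Sum>i\<in>I. \<Sum>j\<in>I. \<Sum>k\<in>I. of_real (sqrt (\<rho> j)) * Z j \<omega> * (of_real (sqrt (\<rho> k)) * cnj (Z k \<omega>)) * (u k i * cnj (u j i)))"
      unfolding b_def cnj_sum complex_cnj_mult sum_product by (simp add: mult_ac)
    also have "\<dots> = (\<Sum>j\<in>I. \<Sum>k\<in>I. of_real (sqrt (\<rho> j)) * Z j \<omega> * (of_real (sqrt (\<rho> k)) * cnj (Z k \<omega>)) * (\<Sum>i\<in>I. u k i * cnj (u j i)))"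
      unfolding sum_distrib_left by (subst sum.swap, rule sum.cong[OF refl], rule sum.swap)
    also have "\<dots> = (\<Sum>j\<in>I. \<Sum>k\<in>I. if k = j then of_real (sqrt (\<rho> j)) * Z j \<omega> * (of_real (sqrt (\<rho> k)) * cnj (Z k \<omega>)) else 0)"
      by (intro sum.cong refl) (auto simp: orth)
    also have "\<dots> = (\<Sum>j\<in>I. of_real (sqrt (\<rho> j)) * Z j \<omega> * (of_real (sqrt (\<rho> j)) * cnj (Z j \<omega>)))"
      using I by simp
    also have "\<dots> = (\<Sum>j\<in>I. of_real (sqrt (\<rho> j) * sqrt (\<rho> j)) * (Z j \<omega> * cnj (Z j \<omega>)))"
      by (simp only: of_real_mult mult_ac)
    also have "\<dots> = (\<Sum>j\<in>I. of_real (\<rho> j * (cmod (Z j \<omega>))\<^sup>2))"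
      using \<rho> by (intro sum.cong refl) (simp only: complex_norm_square[symmetric] of_real_mult[symmetric], simp)
    finally have "complex_of_real (\<Sum>i\<in>I. (cmod (b i \<omega>))\<^sup>2) = of_real (\<Sum>j\<in>I. \<rho> j * (cmod (Z j \<omega>))\<^sup>2)"
      by (simp only: of_real_sum)
    then show ?thesis by (simp only: of_real_eq_iff)
  qed
  \<comment> \<open>The right-hand side is written with a vanishing linear coefficient so that
    \<open>prod\<close> fits it once more.\<close>
  have inner: "(\<integral>\<^sup>+\<omega>. ennreal (G \<omega> \<omega>') \<partial>M) = ennreal ((1 / (1 + m)) ^ card I) *
      ennreal (exp (\<Sum>j\<in>I. 2 * Re (cnj 0 * Z j \<omega>') - (- \<rho> j / (1 + m)) * (cmod (Z j \<omega>'))\<^sup>2))" for \<omega>'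
  proof -
    have "(\<integral>\<^sup>+\<omega>. ennreal (G \<omega> \<omega>') \<partial>M)
        = (\<integral>\<^sup>+\<omega>. ennreal (exp (\<Sum>i\<in>I. 2 * Re (cnj (b i \<omega>') * Z i \<omega>) - m * (cmod (Z i \<omega>))\<^sup>2)) \<partial>M)"
      unfolding G_def exponent by (simp only: sum_subtractf sum_distrib_left)
    also have "\<dots> = ennreal (\<Prod>i\<in>I. exp ((cmod (b i \<omega>'))\<^sup>2 / (1 + m)) / (1 + m))"
      using m by (intro prod)
    also have "(\<Prod>i\<in>I. exp ((cmod (b i \<omega>'))\<^sup>2 / (1 + m)) / (1 + m))
        = (1 / (1 + m)) ^ card I * exp ((\<Sum>i\<in>I. (cmod (b i \<omega>'))\<^sup>2) / (1 + m))"
      by (simp add: prod_dividef exp_sum[OF I] sum_divide_distrib power_divide)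
    also have "(\<Sum>i\<in>I. (cmod (b i \<omega>'))\<^sup>2) / (1 + m)
        = (\<Sum>j\<in>I. 2 * Re (cnj 0 * Z j \<omega>') - (- \<rho> j / (1 + m)) * (cmod (Z j \<omega>'))\<^sup>2)"
      by (simp add: normb sum_divide_distrib)
    finally show ?thesis
      using m by (simp add: ennreal_mult)
  qed
  have "(\<integral>\<^sup>+\<omega>. ennreal (exp ((\<Sum>j\<in>I. \<rho> j * (cmod (y j \<omega>))\<^sup>2) - m * (\<Sum>i\<in>I. (cmod (Z i \<omega>))\<^sup>2))) \<partial>M)
      = (\<integral>\<^sup>+\<omega>. \<integral>\<^sup>+\<omega>'. ennreal (G \<omega> \<omega>') \<partial>M \<partial>M)"
    by (simp only: lin)
  also have "\<dots> = (\<integral>\<^sup>+\<omega>'. \<integral>\<^sup>+\<omega>. ennreal (G \<omega> \<omega>') \<partial>M \<partial>M)"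
  proof (rule P.Fubini'[symmetric])
    have fst: "(\<lambda>p. Z i (fst p)) \<in> borel_measurable (M \<Otimes>\<^sub>M M)"
      and snd: "(\<lambda>p. Z i (snd p)) \<in> borel_measurable (M \<Otimes>\<^sub>M M)" if "i \<in> I" for i
      using that by (auto intro!: measurable_compose[OF measurable_fst] measurable_compose[OF measurable_snd])
    have yfst: "(\<lambda>p. y j (fst p)) \<in> borel_measurable (M \<Otimes>\<^sub>M M)" for j
      by measurable
    note [measurable] = fst snd yfst
    have "(\<lambda>p. \<Sum>j\<in>I. 2 * Re (cnj (of_real (sqrt (\<rho> j)) * y j (fst p)) * Z j (snd p))) \<in> borel_measurable (M \<Otimes>\<^sub>M M)"
    proof (rule borel_measurable_sum)
      fix j assume [measurable]: "j \<in> I"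
      show "(\<lambda>p. 2 * Re (cnj (of_real (sqrt (\<rho> j)) * y j (fst p)) * Z j (snd p))) \<in> borel_measurable (M \<Otimes>\<^sub>M M)"
        using snd[OF \<open>j \<in> I\<close>] unfolding times_complex.simps complex_cnj by simp
    qed
    moreover have "(\<lambda>p. \<Sum>i\<in>I. (cmod (Z i (fst p)))\<^sup>2) \<in> borel_measurable (M \<Otimes>\<^sub>M M)"
    proof (rule borel_measurable_sum)
      fix i assume "i \<in> I"
      then have [measurable]: "(\<lambda>p. Z i (fst p)) \<in> borel_measurable (M \<Otimes>\<^sub>M M)" by (rule fst)
      show "(\<lambda>p. (cmod (Z i (fst p)))\<^sup>2) \<in> borel_measurable (M \<Otimes>\<^sub>M M)" by measurable
    qed
    ultimately show "(\<lambda>(\<omega>, \<omega>'). ennreal (G \<omega> \<omega>')) \<in> borel_measurable (M \<Otimes>\<^sub>M M)"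
      unfolding G_def split_def by measurable
  qed
  \<comment> \<open>The requirement \<open>d j > -1\<close> of \<open>prod\<close> reads
    \<open>\<rho> j < 1 + m\<close> here.\<close>
  also have "\<dots> = ennreal ((1 / (1 + m)) ^ card I) *
      ennreal (\<Prod>j\<in>I. exp ((cmod 0)\<^sup>2 / (1 + (- \<rho> j / (1 + m)))) / (1 + (- \<rho> j / (1 + m))))"
    unfolding inner
    by (subst nn_integral_cmult, measurable, subst prod) (use m \<rho> in \<open>auto simp: field_simps\<close>)
  also have "\<dots> = ennreal ((1 / (1 + m)) ^ card I * (\<Prod>j\<in>I. 1 / (1 + (- \<rho> j / (1 + m)))))"
  proof -
    have "0 \<le> 1 / (1 + (- \<rho> j / (1 + m)))" if "j \<in> I" for j
      using \<rho>[OF that] m by (simp add: field_simps)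
    then show ?thesis
      using m by (subst ennreal_mult[symmetric]) (auto intro!: prod_nonneg)
  qed
  also have "(1 / (1 + m)) ^ card I * (\<Prod>j\<in>I. 1 / (1 + (- \<rho> j / (1 + m))))
      = (\<Prod>j\<in>I. (1 / (1 + m)) * (1 / (1 + (- \<rho> j / (1 + m)))))"
    by (simp only: prod.distrib prod_constant)
  also have "(\<Prod>j\<in>I. (1 / (1 + m)) * (1 / (1 + (- \<rho> j / (1 + m))))) = (\<Prod>j\<in>I. 1 / (1 + m - \<rho> j))"
    using m \<rho> by (intro prod.cong refl) (auto simp: field_simps)
  finally show ?thesis by (simp add: y_def)
qed

section \<open>Exponential moments and Chernoff's bound for centred Hermitian forms\<close>

text \<open>The function \<open>h\<close> has derivative
  \<open>t * (1 / (1 - v) - 1 / (1 - t))\<close>, which has the sign of \<open>t\<close> as long as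
  \<open>t \<le> v\<close>, so its minimum is \<open>h 0 = 0\<close>. The factor
  \<open>1 / (1 - v)\<close> is the price for cutting the logarithmic series after the quadratic
  term.\<close>

lemma inverse_one_minus_le_exp:
  fixes u v :: real
  assumes "\<bar>u\<bar> \<le> v" "v < 1"
  shows "1 / (1 - u) \<le> exp (u + u\<^sup>2 / (2 * (1 - v)))"
proof -
  define h where "h t = t + t\<^sup>2 / (2 * (1 - v)) + ln (1 - t)" for t
  have deriv: "(h has_real_derivative t * (1 / (1 - v) - 1 / (1 - t))) (at t)" if "t \<le> v" for t
    unfolding h_def [abs_def] using that assms
    by (auto intro!: derivative_eq_intros simp: divide_simps) (simp add: algebra_simps)
  have sign: "1 / (1 - v) - 1 / (1 - t) \<ge> 0" if "t \<le> v" for t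
    using that assms by (simp add: frac_le)
  have "h 0 \<le> h u"
  proof (cases "0 \<le> u")
    case True
    then show ?thesis
    proof (rule DERIV_nonneg_imp_nondecreasing)
      fix t assume "0 \<le> t" "t \<le> u"
      then show "\<exists>y. (h has_real_derivative y) (at t) \<and> y \<ge> 0"
        using deriv[of t] sign[of t] assms
        by (intro exI[of _ "t * (1 / (1 - v) - 1 / (1 - t))"] conjI mult_nonneg_nonneg) auto
    qed
  next
    case False
    then have "u \<le> 0" by simp
    then show ?thesis
    proof (rule DERIV_nonpos_imp_nonincreasing)
      fix t assume "u \<le> t" "t \<le> 0"
      then show "\<exists>y. (h has_real_derivative y) (at t) \<and> y \<le> 0"
        using deriv[of t] sign[of t] assms
        by (intro exI[of _ "t * (1 / (1 - v) - 1 / (1 - t))"] conjI mult_nonpos_nonneg) auto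
    qed
  qed
  then have "ln (1 / (1 - u)) \<le> u + u\<^sup>2 / (2 * (1 - v))"
    using assms by (simp add: h_def ln_div)
  then have "exp (ln (1 / (1 - u))) \<le> exp (u + u\<^sup>2 / (2 * (1 - v)))"
    by simp
  then show ?thesis
    using assms by (subst (asm) exp_ln) auto
qed

lemma spectral_sum_squares:
  fixes u :: "nat \<Rightarrow> nat \<Rightarrow> complex" and s :: "nat \<Rightarrow> real"
  assumes orth: "\<And>k l. k < n \<Longrightarrow> l < n \<Longrightarrow> (\<Sum>i<n. u k i * cnj (u l i)) = (if k = l then 1 else 0)"
    and Q: "\<And>i j. i < n \<Longrightarrow> j < n \<Longrightarrow> Q i j = (\<Sum>k<n. of_real (s k) * u k i * cnj (u k j))"
  shows "(\<Sum>i<n. \<Sum>j<n. (cmod (Q i j))\<^sup>2) = (\<Sum>k<n. (s k)\<^sup>2)"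
proof -
  have "complex_of_real (\<Sum>i<n. \<Sum>j<n. (cmod (Q i j))\<^sup>2) = (\<Sum>i<n. \<Sum>j<n. Q i j * cnj (Q i j))"
    unfolding of_real_sum by (intro sum.cong refl) (simp_all only: complex_norm_square)
  also have "\<dots> = (\<Sum>i<n. \<Sum>j<n. \<Sum>k<n. \<Sum>l<n.
      of_real (s k) * of_real (s l) * (u k i * cnj (u l i)) * (u l j * cnj (u k j)))"
    by (intro sum.cong refl) (simp add: Q sum_product mult_ac)
  also have "\<dots> = (\<Sum>k<n. \<Sum>l<n. \<Sum>i<n. \<Sum>j<n.
      of_real (s k) * of_real (s l) * (u k i * cnj (u l i)) * (u l j * cnj (u k j)))"
  proof -
    have "(\<Sum>i<n. \<Sum>j<n. \<Sum>k<n. \<Sum>l<n. f i j k l) = (\<Sum>k<n. \<Sum>l<n. \<Sum>i<n. \<Sum>j<n. f i j k l)" for f :: "nat \<Rightarrow> nat \<Rightarrow> nat \<Rightarrow> nat \<Rightarrow> complex"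
    proof -
      have "(\<Sum>i<n. \<Sum>j<n. \<Sum>k<n. \<Sum>l<n. f i j k l) = (\<Sum>i<n. \<Sum>k<n. \<Sum>j<n. \<Sum>l<n. f i j k l)"
        by (rule sum.cong[OF refl], rule sum.swap)
      also have "\<dots> = (\<Sum>i<n. \<Sum>k<n. \<Sum>l<n. \<Sum>j<n. f i j k l)"
        by (rule sum.cong[OF refl], rule sum.cong[OF refl], rule sum.swap)
      also have "\<dots> = (\<Sum>k<n. \<Sum>i<n. \<Sum>l<n. \<Sum>j<n. f i j k l)"
        by (rule sum.swap)
      also have "\<dots> = (\<Sum>k<n. \<Sum>l<n. \<Sum>i<n. \<Sum>j<n. f i j k l)"
        by (rule sum.cong[OF refl], rule sum.swap)
      finally show ?thesis .
    qed
    then show ?thesis .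
  qed
  also have "\<dots> = (\<Sum>k<n. \<Sum>l<n. of_real (s k) * of_real (s l) *
      ((\<Sum>i<n. u k i * cnj (u l i)) * (\<Sum>j<n. u l j * cnj (u k j))))"
    by (simp add: sum_product) (simp add: sum_distrib_left mult_ac)
  also have "\<dots> = (\<Sum>k<n. \<Sum>l<n. if k = l then of_real (s k) * of_real (s l) else 0)"
    by (intro sum.cong refl) (auto simp: orth)
  also have "\<dots> = (\<Sum>k<n. of_real ((s k)\<^sup>2))"
    by (simp add: power2_eq_square)
  finally have "complex_of_real (\<Sum>i<n. \<Sum>j<n. (cmod (Q i j))\<^sup>2) = of_real (\<Sum>k<n. (s k)\<^sup>2)"
    by simp
  then show ?thesis by (simp only: of_real_eq_iff)
qed

lemma quadratic_form_spectral:
  fixes u :: "nat \<Rightarrow> nat \<Rightarrow> complex" and s :: "nat \<Rightarrow> real"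
  assumes Q: "\<And>i j. i < n \<Longrightarrow> j < n \<Longrightarrow> Q i j = (\<Sum>k<n. of_real (s k) * u k i * cnj (u k j))"
  shows "(\<Sum>i<n. \<Sum>j<n. w i * cnj (w j) * Q i j)
       = of_real (\<Sum>k<n. s k * (cmod (\<Sum>i<n. u k i * w i))\<^sup>2)"
proof -
  have "(\<Sum>i<n. \<Sum>j<n. w i * cnj (w j) * Q i j)
      = (\<Sum>i<n. \<Sum>j<n. \<Sum>k<n. of_real (s k) * ((u k i * w i) * cnj (u k j * w j)))"
    by (intro sum.cong refl) (simp add: Q sum_distrib_left mult_ac)
  also have "\<dots> = (\<Sum>i<n. \<Sum>k<n. \<Sum>j<n. of_real (s k) * ((u k i * w i) * cnj (u k j * w j)))"
    by (rule sum.cong[OF refl], rule sum.swap)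
  also have "\<dots> = (\<Sum>k<n. \<Sum>i<n. \<Sum>j<n. of_real (s k) * ((u k i * w i) * cnj (u k j * w j)))"
    by (rule sum.swap)
  also have "\<dots> = (\<Sum>k<n. of_real (s k) * ((\<Sum>i<n. u k i * w i) * cnj (\<Sum>j<n. u k j * w j)))"
    unfolding cnj_sum sum_product by (simp add: sum_distrib_left)
  also have "\<dots> = of_real (\<Sum>k<n. s k * (cmod (\<Sum>i<n. u k i * w i))\<^sup>2)"
    unfolding of_real_sum of_real_mult complex_norm_square ..
  finally show ?thesis .
qed

lemma parseval_unitary:
  fixes u :: "nat \<Rightarrow> nat \<Rightarrow> complex"
  assumes compl: "\<And>i j. i < n \<Longrightarrow> j < n \<Longrightarrow> (\<Sum>k<n. u k i * cnj (u k j)) = (if i = j then 1 else 0)"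
  shows "(\<Sum>k<n. (cmod (\<Sum>i<n. u k i * w i))\<^sup>2) = (\<Sum>i<n. (cmod (w i))\<^sup>2)"
proof -
  \<comment> \<open>The explicit factor \<open>1\<close> presents the identity matrix as a spectral
    decomposition with all eigenvalues 1.\<close>
  have "complex_of_real (\<Sum>k<n. 1 * (cmod (\<Sum>i<n. u k i * w i))\<^sup>2)
      = (\<Sum>i<n. \<Sum>j<n. w i * cnj (w j) * (if i = j then 1 else 0))"
    by (rule quadratic_form_spectral[symmetric]) (simp add: compl)
  also have "\<dots> = (\<Sum>i<n. w i * cnj (w i))"
    by (simp add: if_distrib[of "(*) _"] cong: if_cong)
  also have "\<dots> = of_real (\<Sum>i<n. (cmod (w i))\<^sup>2)"
    unfolding of_real_sum complex_norm_square ..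
  finally show ?thesis by (simp only: of_real_eq_iff mult_1)
qed

text \<open>The exponential moment of the uncentred form is the product of
  \<open>1 / (1 - s k)\<close> over eigenvalues and rows. The Frobenius bound \<open>v\<close>
  bounds every \<open>s k\<close> as well, so each factor is at most
  \<open>exp (s k + (s k)\<^sup>2 / (2 * (1 - v)))\<close>, and the linear terms cancel the
  trace.\<close>

lemma gaussian_quadratic_form_mgf_le:
  fixes Q :: "nat \<Rightarrow> nat \<Rightarrow> complex"
  assumes "prob_space M" and W: "iid_complex_gaussian_mat M N T W"
    and herm: "\<And>i j. i < T \<Longrightarrow> j < T \<Longrightarrow> Q j i = cnj (Q i j)"
    and Qv: "(\<Sum>i<T. \<Sum>j<T. (cmod (Q i j))\<^sup>2) \<le> v\<^sup>2" and v: "0 \<le> v" "v < 1"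
  shows "(\<integral>\<^sup>+\<omega>. ennreal (exp ((\<Sum>n<N. Re (\<Sum>i<T. \<Sum>j<T. W \<omega> $$ (n, i) * cnj (W \<omega> $$ (n, j)) * Q i j))
             - real N * Re (\<Sum>i<T. Q i i))) \<partial>M)
       \<le> ennreal (exp (real N * v\<^sup>2 / (2 * (1 - v))))"
proof -
  interpret prob_space M by fact
  obtain s :: "nat \<Rightarrow> real" and u where
    orth: "\<And>k l. k < T \<Longrightarrow> l < T \<Longrightarrow> (\<Sum>i<T. u k i * cnj (u l i)) = (if k = l then 1 else 0)"
    and compl: "\<And>i j. i < T \<Longrightarrow> j < T \<Longrightarrow> (\<Sum>k<T. u k i * cnj (u k j)) = (if i = j then 1 else 0)"
    and Q: "\<And>i j. i < T \<Longrightarrow> j < T \<Longrightarrow> Q i j = (\<Sum>k<T. of_real (s k) * u k i * cnj (u k j))"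
  proof (rule hermitian_spectral_decomposition[of T Q])
    show "Q j i = cnj (Q i j)" if "i < T" "j < T" for i j
      using that by (rule herm)
  qed (blast intro: that)
  have sq: "(\<Sum>k<T. (s k)\<^sup>2) \<le> v\<^sup>2"
    using spectral_sum_squares[OF orth Q] Qv by simp
  have s: "\<bar>s k\<bar> \<le> v" if "k < T" for k
  proof -
    have "(s k)\<^sup>2 \<le> (\<Sum>k<T. (s k)\<^sup>2)"
      using that by (intro member_le_sum) auto
    then have "\<bar>s k\<bar>\<^sup>2 \<le> v\<^sup>2" using sq by simp
    then show ?thesis using v(1) by (rule power2_le_imp_le)
  qed
  have "(\<Sum>i<T. Q i i) = (\<Sum>i<T. \<Sum>k<T. of_real (s k) * (u k i * cnj (u k i)))"
    by (simp add: Q mult_ac)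
  also have "\<dots> = (\<Sum>k<T. of_real (s k) * (\<Sum>i<T. u k i * cnj (u k i)))"
    by (subst sum.swap) (simp add: sum_distrib_left)
  also have "\<dots> = of_real (\<Sum>k<T. s k)"
    by (simp add: orth)
  finally have tr: "Re (\<Sum>i<T. Q i i) = (\<Sum>k<T. s k)" by simp
  define I where "I = {..<N} \<times> {..<T}"
  define Z where "Z = (\<lambda>(n, t) \<omega>. W \<omega> $$ (n, t))"
  \<comment> \<open>One copy of the eigenbasis per row: the block diagonal unitary that treats all
    entries of \<open>W\<close> at once.\<close>
  define u' where "u' = (\<lambda>(n :: nat, k) (n', i). if n = n' then u k i else (0::complex))"
  \<comment> \<open>Since \<open>\<bar>s k\<bar> < 1\<close>, the shift by 1 places the coefficients
    in the interval from 0 to 2. The weight \<open>m = 1\<close> undoes the shift, because the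
    unitary preserves the sum of squares.\<close>
  define \<rho> where "\<rho> = (\<lambda>(n::nat, k). s k + 1)"
  have fin: "finite I" by (simp add: I_def)
  have sumI_complex: "(\<Sum>p\<in>I. f p) = (\<Sum>n<N. \<Sum>k<T. f (n, k))" for f :: "nat \<times> nat \<Rightarrow> complex"
    by (simp add: I_def sum.cartesian_product)
  have sumI: "(\<Sum>p\<in>I. f p) = (\<Sum>n<N. \<Sum>k<T. f (n, k))" for f :: "nat \<times> nat \<Rightarrow> real"
    by (simp add: I_def sum.cartesian_product)
  have row: "(\<Sum>p\<in>I. u' (n, k) p * f p) = (\<Sum>i<T. u k i * f (n, i))" if "n < N" for n k f
  proof -
    have "(\<Sum>p\<in>I. u' (n, k) p * f p) = (\<Sum>n'<N. if n = n' then (\<Sum>i<T. u k i * f (n', i)) else 0)"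
      unfolding sumI_complex by (intro sum.cong refl) (simp add: u'_def)
    then show ?thesis using that by simp
  qed
  have "(\<integral>\<^sup>+\<omega>. ennreal (exp ((\<Sum>p\<in>I. \<rho> p * (cmod (\<Sum>i\<in>I. u' p i * Z i \<omega>))\<^sup>2)
            - 1 * (\<Sum>i\<in>I. (cmod (Z i \<omega>))\<^sup>2))) \<partial>M)
       = ennreal (\<Prod>p\<in>I. 1 / (1 + 1 - \<rho> p))"
  proof (rule nn_integral_complex_gaussian_exp_form)
    show "indep_vars (\<lambda>_. borel) Z I"
      using W by (simp add: iid_complex_gaussian_mat_def I_def Z_def)
    show "standard_complex_gaussian M (Z i)" if "i \<in> I" for i
      using W that by (auto simp: iid_complex_gaussian_mat_def I_def Z_def)
    show "(\<Sum>i\<in>I. u' p i * cnj (u' q i)) = (if p = q then 1 else 0)" if mem: "p \<in> I" "q \<in> I" for p q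
    proof -
      obtain n k n' l where pq: "p = (n, k)" "q = (n', l)" "n < N" "k < T" "n' < N" "l < T"
        using mem by (auto simp: I_def)
      have "(\<Sum>i\<in>I. u' p i * cnj (u' q i)) = (\<Sum>i<T. u k i * cnj (u' q (n, i)))"
        unfolding pq(1) by (rule row) (rule pq)
      also have "\<dots> = (if n = n' then \<Sum>i<T. u k i * cnj (u l i) else 0)"
        by (auto simp: u'_def pq(2))
      finally show ?thesis
        using orth[OF pq(4,6)] unfolding pq(1,2) by auto
    qed
    show "0 \<le> \<rho> p \<and> \<rho> p < 1 + 1" if "p \<in> I" for p
    proof -
      have "\<bar>s (snd p)\<bar> \<le> v" using that s by (auto simp: I_def)
      then show ?thesis using v by (auto simp: \<rho>_def split_def)
    qed
  qed (use assms(1) fin in auto)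
  also have "(\<lambda>\<omega>. (\<Sum>p\<in>I. \<rho> p * (cmod (\<Sum>i\<in>I. u' p i * Z i \<omega>))\<^sup>2) - 1 * (\<Sum>i\<in>I. (cmod (Z i \<omega>))\<^sup>2))
      = (\<lambda>\<omega>. \<Sum>n<N. Re (\<Sum>i<T. \<Sum>j<T. W \<omega> $$ (n, i) * cnj (W \<omega> $$ (n, j)) * Q i j))"
  proof
    fix \<omega>
    have "(\<Sum>p\<in>I. \<rho> p * (cmod (\<Sum>i\<in>I. u' p i * Z i \<omega>))\<^sup>2)
        = (\<Sum>n<N. \<Sum>k<T. s k * (cmod (\<Sum>i<T. u k i * W \<omega> $$ (n, i)))\<^sup>2
            + (cmod (\<Sum>i<T. u k i * W \<omega> $$ (n, i)))\<^sup>2)"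
      unfolding sumI[of "\<lambda>p. \<rho> p * _ p"] by (intro sum.cong refl) (simp add: row \<rho>_def Z_def distrib_right)
    also have "\<dots> = (\<Sum>n<N. Re (\<Sum>i<T. \<Sum>j<T. W \<omega> $$ (n, i) * cnj (W \<omega> $$ (n, j)) * Q i j))
        + (\<Sum>n<N. \<Sum>i<T. (cmod (W \<omega> $$ (n, i)))\<^sup>2)"
    proof -
      have "(\<Sum>k<T. (cmod (\<Sum>i<T. u k i * w i))\<^sup>2) = (\<Sum>i<T. (cmod (w i))\<^sup>2)" for w
        by (rule parseval_unitary) (rule compl)
      moreover have "(\<Sum>i<T. \<Sum>j<T. w i * cnj (w j) * Q i j)
          = of_real (\<Sum>k<T. s k * (cmod (\<Sum>i<T. u k i * w i))\<^sup>2)" for w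
        by (rule quadratic_form_spectral) (rule Q)
      ultimately show ?thesis
        by (simp only: sum.distrib Re_complex_of_real)
    qed
    finally show "(\<Sum>p\<in>I. \<rho> p * (cmod (\<Sum>i\<in>I. u' p i * Z i \<omega>))\<^sup>2) - 1 * (\<Sum>i\<in>I. (cmod (Z i \<omega>))\<^sup>2)
        = (\<Sum>n<N. Re (\<Sum>i<T. \<Sum>j<T. W \<omega> $$ (n, i) * cnj (W \<omega> $$ (n, j)) * Q i j))"
      by (simp add: sumI Z_def)
  qed
  finally have mgf: "(\<integral>\<^sup>+\<omega>. ennreal (exp (\<Sum>n<N. Re (\<Sum>i<T. \<Sum>j<T. W \<omega> $$ (n, i) * cnj (W \<omega> $$ (n, j)) * Q i j))) \<partial>M)
      = ennreal (\<Prod>p\<in>I. 1 / (1 + 1 - \<rho> p))" .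
  have "(\<Prod>p\<in>I. 1 / (1 + 1 - \<rho> p)) \<le> (\<Prod>p\<in>I. exp (s (snd p) + (s (snd p))\<^sup>2 / (2 * (1 - v))))"
  proof (rule prod_mono)
    fix p assume "p \<in> I"
    then have "\<bar>s (snd p)\<bar> \<le> v" using s by (auto simp: I_def)
    then show "0 \<le> 1 / (1 + 1 - \<rho> p) \<and> 1 / (1 + 1 - \<rho> p) \<le> exp (s (snd p) + (s (snd p))\<^sup>2 / (2 * (1 - v)))"
      using v inverse_one_minus_le_exp[of "s (snd p)" v] by (auto simp: \<rho>_def split_def)
  qed
  also have "\<dots> = exp (\<Sum>n<N. \<Sum>k<T. s k + (s k)\<^sup>2 / (2 * (1 - v)))"
    by (simp add: exp_sum[OF fin, symmetric] sumI)
  also have "\<dots> = exp (real N * Re (\<Sum>i<T. Q i i)) * exp (real N * ((\<Sum>k<T. (s k)\<^sup>2) / (2 * (1 - v))))"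
    unfolding tr by (simp add: sum.distrib exp_add distrib_left sum_divide_distrib)
  also have "\<dots> \<le> exp (real N * Re (\<Sum>i<T. Q i i)) * exp (real N * (v\<^sup>2 / (2 * (1 - v))))"
    using sq v by (intro mult_left_mono) (auto intro!: mult_left_mono divide_right_mono)
  finally have prod: "(\<Prod>p\<in>I. 1 / (1 + 1 - \<rho> p)) \<le> exp (real N * Re (\<Sum>i<T. Q i i)) * exp (real N * (v\<^sup>2 / (2 * (1 - v))))" .
  have meas: "(\<lambda>\<omega>. W \<omega> $$ (n, i)) \<in> borel_measurable M" if "n < N" "i < T" for n i
    using W that unfolding iid_complex_gaussian_mat_def indep_vars_def by auto
  have "(\<integral>\<^sup>+\<omega>. ennreal (exp ((\<Sum>n<N. Re (\<Sum>i<T. \<Sum>j<T. W \<omega> $$ (n, i) * cnj (W \<omega> $$ (n, j)) * Q i j))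
             - real N * Re (\<Sum>i<T. Q i i))) \<partial>M)
      = (\<integral>\<^sup>+\<omega>. ennreal (exp (- (real N * Re (\<Sum>i<T. Q i i)))) *
          ennreal (exp (\<Sum>n<N. Re (\<Sum>i<T. \<Sum>j<T. W \<omega> $$ (n, i) * cnj (W \<omega> $$ (n, j)) * Q i j))) \<partial>M)"
    by (intro nn_integral_cong) (simp add: ennreal_mult[symmetric] exp_add[symmetric])
  also have "\<dots> = ennreal (exp (- (real N * Re (\<Sum>i<T. Q i i)))) * ennreal (\<Prod>p\<in>I. 1 / (1 + 1 - \<rho> p))"
  proof (subst nn_integral_cmult)
    have "(\<lambda>\<omega>. Re (W \<omega> $$ (n, i) * cnj (W \<omega> $$ (n, j)) * Q i j)) \<in> borel_measurable M"
      if "n < N" "i < T" "j < T" for n i j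
    proof -
      note [measurable] = meas[OF that(1,2)] meas[OF that(1,3)]
      show ?thesis unfolding times_complex.simps complex_cnj by simp
    qed
    then show "(\<lambda>\<omega>. ennreal (exp (\<Sum>n<N. Re (\<Sum>i<T. \<Sum>j<T. W \<omega> $$ (n, i) * cnj (W \<omega> $$ (n, j)) * Q i j))))
        \<in> borel_measurable M"
      unfolding Re_sum by (auto intro!: measurable_compose[OF _ measurable_ennreal] borel_measurable_exp borel_measurable_sum)
  qed (simp only: mgf)
  also have "\<dots> \<le> ennreal (exp (- (real N * Re (\<Sum>i<T. Q i i)))) *
      ennreal (exp (real N * Re (\<Sum>i<T. Q i i)) * exp (real N * (v\<^sup>2 / (2 * (1 - v)))))"
    by (intro mult_left_mono ennreal_leI prod) auto
  also have "\<dots> = ennreal (exp (real N * v\<^sup>2 / (2 * (1 - v))))"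
    by (simp add: ennreal_mult[symmetric] exp_add[symmetric])
  finally show ?thesis .
qed

text \<open>In the last factor of the exponent, 2 comes from the linear term of Chernoff's bound and
  \<open>1 / (1 - x / F)\<close> from the quadratic one; the factor tends to 1 as \<open>F\<close>
  grows.\<close>

lemma gaussian_quadratic_form_tail:
  fixes Q :: "nat \<Rightarrow> nat \<Rightarrow> complex"
  assumes "prob_space M" and W: "iid_complex_gaussian_mat M N T W"
    and herm: "\<And>i j. i < T \<Longrightarrow> j < T \<Longrightarrow> Q j i = cnj (Q i j)"
    and QF: "(\<Sum>i<T. \<Sum>j<T. (cmod (Q i j))\<^sup>2) \<le> F\<^sup>2"
    and x: "0 < x" "x < F"
  defines "E \<equiv> {\<omega> \<in> space M. real N * x \<le>
      (\<Sum>n<N. Re (\<Sum>i<T. \<Sum>j<T. W \<omega> $$ (n, i) * cnj (W \<omega> $$ (n, j)) * Q i j)) - real N * Re (\<Sum>i<T. Q i i)}"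
  shows "E \<in> sets M"
    and "measure M E \<le> exp (- (real N * x\<^sup>2 / (2 * F\<^sup>2) * (2 - 1 / (1 - x / F))))"
proof -
  interpret prob_space M by fact
  define X where "X \<omega> = (\<Sum>n<N. Re (\<Sum>i<T. \<Sum>j<T. W \<omega> $$ (n, i) * cnj (W \<omega> $$ (n, j)) * Q i j))
      - real N * Re (\<Sum>i<T. Q i i)" for \<omega>
  have E: "E = {\<omega> \<in> space M. real N * x \<le> X \<omega>}"
    by (simp add: E_def X_def)
  have meas: "(\<lambda>\<omega>. W \<omega> $$ (n, i)) \<in> borel_measurable M" if "n < N" "i < T" for n i
    using W that unfolding iid_complex_gaussian_mat_def indep_vars_def by auto
  have "(\<lambda>\<omega>. Re (W \<omega> $$ (n, i) * cnj (W \<omega> $$ (n, j)) * Q i j)) \<in> borel_measurable M"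
    if "n < N" "i < T" "j < T" for n i j
  proof -
    note [measurable] = meas[OF that(1,2)] meas[OF that(1,3)]
    show ?thesis unfolding times_complex.simps complex_cnj by simp
  qed
  then have X [measurable]: "X \<in> borel_measurable M"
    unfolding X_def [abs_def] Re_sum by (intro borel_measurable_diff borel_measurable_sum) auto
  then show "E \<in> sets M" unfolding E by measurable
  \<comment> \<open>The minimiser of \<open>- \<tau> * x + \<tau>\<^sup>2 * F\<^sup>2 / 2\<close>.
    The scaled matrix has Frobenius norm at most \<open>x / F\<close>, which is below 1 because
    \<open>x < F\<close>.\<close>
  define \<tau> where "\<tau> = x / F\<^sup>2"
  have \<tau>: "\<tau> > 0" using x by (simp add: \<tau>_def)
  have \<tau>F: "\<tau>\<^sup>2 * F\<^sup>2 = (x / F)\<^sup>2"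
    using x by (simp add: \<tau>_def power_divide power2_eq_square)
  have "(\<integral>\<^sup>+\<omega>. ennreal (exp ((\<Sum>n<N. Re (\<Sum>i<T. \<Sum>j<T. W \<omega> $$ (n, i) * cnj (W \<omega> $$ (n, j)) * (of_real \<tau> * Q i j)))
             - real N * Re (\<Sum>i<T. of_real \<tau> * Q i i))) \<partial>M)
       \<le> ennreal (exp (real N * (x / F)\<^sup>2 / (2 * (1 - x / F))))"
  proof (rule gaussian_quadratic_form_mgf_le)
    show "of_real \<tau> * Q j i = cnj (of_real \<tau> * Q i j)" if "i < T" "j < T" for i j
      using herm[OF that] by simp
    have "(\<Sum>i<T. \<Sum>j<T. (cmod (of_real \<tau> * Q i j))\<^sup>2) = \<tau>\<^sup>2 * (\<Sum>i<T. \<Sum>j<T. (cmod (Q i j))\<^sup>2)"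
      by (simp add: norm_mult power_mult_distrib sum_distrib_left)
    also have "\<dots> \<le> \<tau>\<^sup>2 * F\<^sup>2"
      by (intro mult_left_mono QF) simp
    finally show "(\<Sum>i<T. \<Sum>j<T. (cmod (of_real \<tau> * Q i j))\<^sup>2) \<le> (x / F)\<^sup>2"
      by (simp only: \<tau>F)
  qed (use x assms(1) W in auto)
  also have "(\<lambda>\<omega>. (\<Sum>n<N. Re (\<Sum>i<T. \<Sum>j<T. W \<omega> $$ (n, i) * cnj (W \<omega> $$ (n, j)) * (of_real \<tau> * Q i j)))
             - real N * Re (\<Sum>i<T. of_real \<tau> * Q i i)) = (\<lambda>\<omega>. \<tau> * X \<omega>)"
  proof
    fix \<omega>
    have form: "Re (\<Sum>i<T. \<Sum>j<T. w i * cnj (w j) * (of_real \<tau> * Q i j)) = \<tau> * Re (\<Sum>i<T. \<Sum>j<T. w i * cnj (w j) * Q i j)" for w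
    proof -
      have "(\<Sum>i<T. \<Sum>j<T. w i * cnj (w j) * (of_real \<tau> * Q i j)) = of_real \<tau> * (\<Sum>i<T. \<Sum>j<T. w i * cnj (w j) * Q i j)"
        by (simp add: sum_distrib_left mult_ac)
      then show ?thesis by simp
    qed
    have trace: "Re (\<Sum>i<T. of_real \<tau> * Q i i) = \<tau> * Re (\<Sum>i<T. Q i i)"
      by (simp add: sum_distrib_left)
    show "(\<Sum>n<N. Re (\<Sum>i<T. \<Sum>j<T. W \<omega> $$ (n, i) * cnj (W \<omega> $$ (n, j)) * (of_real \<tau> * Q i j)))
             - real N * Re (\<Sum>i<T. of_real \<tau> * Q i i) = \<tau> * X \<omega>"
      by (simp only: form trace X_def right_diff_distrib) (simp only: sum_distrib_left mult.left_commute)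
  qed
  finally have mgf: "(\<integral>\<^sup>+\<omega>. ennreal (exp (\<tau> * X \<omega>)) \<partial>M) \<le> ennreal (exp (real N * (x / F)\<^sup>2 / (2 * (1 - x / F))))" .
  have "emeasure M E \<le> ennreal (exp (- \<tau> * (real N * x))) * (\<integral>\<^sup>+\<omega>. ennreal (exp (\<tau> * X \<omega>)) * indicator (space M) \<omega> \<partial>M)"
    unfolding E using \<tau> by (intro Chernoff_ineq_nn_integral_ge) auto
  also have "(\<integral>\<^sup>+\<omega>. ennreal (exp (\<tau> * X \<omega>)) * indicator (space M) \<omega> \<partial>M) = (\<integral>\<^sup>+\<omega>. ennreal (exp (\<tau> * X \<omega>)) \<partial>M)"
    by (intro nn_integral_cong) simp
  also have "ennreal (exp (- \<tau> * (real N * x))) * \<dots>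
      \<le> ennreal (exp (- \<tau> * (real N * x))) * ennreal (exp (real N * (x / F)\<^sup>2 / (2 * (1 - x / F))))"
    by (intro mult_left_mono mgf) auto
  also have "\<dots> = ennreal (exp (- (real N * x\<^sup>2 / (2 * F\<^sup>2) * (2 - 1 / (1 - x / F)))))"
  proof -
    have "- \<tau> * (real N * x) + real N * (x / F)\<^sup>2 / (2 * (1 - x / F))
        = - (real N * x\<^sup>2 / (2 * F\<^sup>2) * (2 - 1 / (1 - x / F)))"
    proof -
      have "real N * (x / F)\<^sup>2 / (2 * (1 - x / F)) = real N * x\<^sup>2 / (2 * F\<^sup>2) * (1 / (1 - x / F))"
        by (simp add: power_divide)
      moreover have "\<tau> * (real N * x) = real N * x\<^sup>2 / (2 * F\<^sup>2) * 2"
        by (simp add: \<tau>_def power2_eq_square)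
      ultimately show ?thesis
        unfolding right_diff_distrib by simp
    qed
    then show ?thesis
      by (simp only: ennreal_mult[symmetric] exp_ge_zero exp_add[symmetric])
  qed
  finally show "measure M E \<le> exp (- (real N * x\<^sup>2 / (2 * F\<^sup>2) * (2 - 1 / (1 - x / F))))"
    by (simp add: emeasure_eq_measure)
qed

section \<open>Toeplitz matrices and their symbols\<close>

text \<open>The sign in the exponent is that of \<open>spectral_density\<close>, so these are its
  symmetric partial sums. For \<open>L = T - 1\<close> this is the symbol of a Toeplitz matrix of
  size \<open>T\<close>.\<close>

definition trig_poly :: "nat \<Rightarrow> (int \<Rightarrow> complex) \<Rightarrow> real \<Rightarrow> complex" where
  "trig_poly L a l = (\<Sum>k = - int L..int L. a k * cis (- (of_int k * l)))"

text \<open>A geometric sum of powers of a \<open>K\<close>-th root of unity, which equals 1 only if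
  \<open>K\<close> divides \<open>m\<close>; the bound on \<open>m\<close> leaves only
  \<open>m = 0\<close>.\<close>

lemma sum_cis_grid:
  assumes "\<bar>m\<bar> < int K"
  shows "(\<Sum>l<K. cis (of_int m * (2 * pi * real l / real K))) = (if m = 0 then of_nat K else 0)"
proof (cases "m = 0")
  case False
  have K: "K > 0" using assms by simp
  define z where "z = cis (of_int m * (2 * pi / real K))"
  have pow: "cis (of_int m * (2 * pi * real l / real K)) = z ^ l" for l
  proof -
    have eq: "of_int m * (2 * pi * real l / real K) = real l * (of_int m * (2 * pi / real K))"
      by simp
    show ?thesis unfolding z_def Complex.DeMoivre eq ..
  qed
  have "real K * (of_int m * (2 * pi / real K)) = 2 * pi * of_int m"
    using K by simp
  then have "z ^ K = cis (2 * pi * of_int m)"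
    unfolding z_def Complex.DeMoivre by (rule arg_cong)
  also have "\<dots> = 1"
    by (simp add: cis_multiple_2pi)
  finally have zK: "z ^ K = 1" .
  have "z \<noteq> 1"
  proof
    assume "z = 1"
    then have "cos (of_int m * (2 * pi / real K)) = 1"
      by (simp add: z_def complex_eq_iff)
    then obtain j :: int where "of_int m * (2 * pi / real K) = of_int j * 2 * pi"
      by (auto simp: cos_one_2pi_int)
    then have "of_int m = (of_int j * real K)"
      using K by (simp add: field_simps)
    then have "m = j * int K"
      by (metis of_int_eq_iff of_int_mult of_int_of_nat_eq)
    then show False
      using False assms by (auto simp: abs_mult)
  qed
  then show ?thesis
    using False zK unfolding pow by (simp add: geometric_sum)
qed simp

lemma cis_times_cnj_cis:
  "cis (real j * t) * cnj (cis (real i * t)) = cis (of_int (int j - int i) * t)"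
proof -
  have "real j * t + - (real i * t) = of_int (int j - int i) * t"
    by (simp add: left_diff_distrib)
  then show ?thesis unfolding cis_cnj cis_mult by (rule arg_cong)
qed

text \<open>The inverse discrete Fourier transform recovers the coefficients.
  \<open>T \<le> L + 1\<close> puts the lag \<open>j - i\<close> among the frequencies of the
  polynomial; \<open>L + T \<le> K\<close> keeps \<open>j - i - k\<close> below \<open>K\<close> in
  modulus, so nothing is aliased.\<close>

lemma toeplitz_entry_grid:
  assumes T: "T \<le> L + 1" and K: "L + T \<le> K" and "i < T" "j < T"
  shows "(\<Sum>l<K. trig_poly L a (2 * pi * real l / real K) *
           (cis (real j * (2 * pi * real l / real K)) * cnj (cis (real i * (2 * pi * real l / real K)))))
         = of_nat K * a (int j - int i)"
proof -
  have "(\<Sum>l<K. trig_poly L a (2 * pi * real l / real K) *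
           (cis (real j * (2 * pi * real l / real K)) * cnj (cis (real i * (2 * pi * real l / real K)))))
      = (\<Sum>l<K. \<Sum>k = - int L..int L. a k * cis (of_int (int j - int i - k) * (2 * pi * real l / real K)))"
  proof -
    have "a k * cis (- (of_int k * t)) * cis (of_int (int j - int i) * t) = a k * cis (of_int (int j - int i - k) * t)" for k t
      by (simp add: cis_mult algebra_simps)
    then show ?thesis
      unfolding trig_poly_def sum_distrib_right cis_times_cnj_cis by (simp only:)
  qed
  also have "\<dots> = (\<Sum>k = - int L..int L. a k * (\<Sum>l<K. cis (of_int (int j - int i - k) * (2 * pi * real l / real K))))"
    by (subst sum.swap) (simp add: sum_distrib_left)
  also have "\<dots> = (\<Sum>k = - int L..int L. a k * (if int j - int i - k = 0 then of_nat K else 0))"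
    using assms by (intro sum.cong refl arg_cong2[where f = "(*)"] sum_cis_grid) auto
  also have "\<dots> = (\<Sum>k = - int L..int L. if k = int j - int i then a k * of_nat K else 0)"
    by (intro sum.cong refl) auto
  also have "\<dots> = of_nat K * a (int j - int i)"
    using assms by simp
  finally show ?thesis .
qed

lemma parseval_grid:
  assumes "T \<le> K"
  shows "(\<Sum>l<K. (cmod (\<Sum>j<T. cis (real j * (2 * pi * real l / real K)) * v j))\<^sup>2)
       = real K * (\<Sum>j<T. (cmod (v j))\<^sup>2)"
proof -
  have "complex_of_real (\<Sum>l<K. (cmod (\<Sum>j<T. cis (real j * (2 * pi * real l / real K)) * v j))\<^sup>2)
      = (\<Sum>l<K. \<Sum>j<T. \<Sum>i<T. v j * cnj (v i) * cis (of_int (int j - int i) * (2 * pi * real l / real K)))"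
    unfolding of_real_sum complex_norm_square cnj_sum sum_product
    by (simp only: cis_times_cnj_cis[symmetric] complex_cnj_mult mult_ac)
  also have "\<dots> = (\<Sum>j<T. \<Sum>l<K. \<Sum>i<T. v j * cnj (v i) * cis (of_int (int j - int i) * (2 * pi * real l / real K)))"
    by (rule sum.swap)
  also have "\<dots> = (\<Sum>j<T. \<Sum>i<T. \<Sum>l<K. v j * cnj (v i) * cis (of_int (int j - int i) * (2 * pi * real l / real K)))"
    by (rule sum.cong[OF refl], rule sum.swap)
  also have "\<dots> = (\<Sum>j<T. \<Sum>i<T. v j * cnj (v i) * (if int j - int i = 0 then of_nat K else 0))"
    unfolding sum_distrib_left[symmetric]
    using assms by (intro sum.cong refl arg_cong2[where f = "(*)"] sum_cis_grid) auto
  also have "\<dots> = (\<Sum>j<T. \<Sum>i<T. if j = i then v j * cnj (v i) * of_nat K else 0)"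
    by (intro sum.cong refl) auto
  also have "\<dots> = of_nat K * (\<Sum>j<T. v j * cnj (v j))"
    by (simp add: sum_distrib_left mult_ac)
  also have "\<dots> = of_real (real K * (\<Sum>j<T. (cmod (v j))\<^sup>2))"
    unfolding of_real_mult of_real_sum complex_norm_square by simp
  finally show ?thesis by (simp only: of_real_eq_iff)
qed

text \<open>The Toeplitz matrix is a corner of a \<open>K \<times> K\<close> circulant matrix, which the discrete Fourier
  transform diagonalises with eigenvalues the values of the symbol on the grid. So no supremum
  over a continuum has to be controlled.\<close>

lemma toeplitz_form_bound:
  assumes T: "T \<le> L + 1" and K: "L + T \<le> K" "0 < K"
    and P: "\<And>l. l < K \<Longrightarrow> cmod (trig_poly L a (2 * pi * real l / real K)) \<le> P"
  shows "(\<Sum>i<T. (cmod (\<Sum>j<T. a (int j - int i) * v j))\<^sup>2) \<le> P\<^sup>2 * (\<Sum>j<T. (cmod (v j))\<^sup>2)"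
proof -
  define b where "b i = (\<Sum>j<T. a (int j - int i) * v j)" for i
  \<comment> \<open>The squared norm of the image \<open>b\<close> is also the pairing of the
    Toeplitz image of \<open>v\<close> with \<open>b\<close>. On the grid this pairing is diagonal,
    and Cauchy-Schwarz bounds \<open>\<beta>\<^sup>2\<close> by \<open>P\<^sup>2\<close> times the
    squared norm of \<open>v\<close> times \<beta>, from which one \<beta> is cancelled.\<close>
  define \<beta> where "\<beta> = (\<Sum>i<T. (cmod (b i))\<^sup>2)"
  define c where "c j l = cis (real j * (2 * pi * real l / real K))" for j l :: nat
  define p where "p l = trig_poly L a (2 * pi * real l / real K)" for l :: nat
  define hat where "hat w l = (\<Sum>j<T. c j l * w j)" for w l
  have P0: "P \<ge> 0" using P[of 0] K norm_ge_zero order_trans by blast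
  have pars: "(\<Sum>l<K. (cmod (hat w l))\<^sup>2) = real K * (\<Sum>j<T. (cmod (w j))\<^sup>2)" for w
    unfolding hat_def c_def using K by (intro parseval_grid) simp
  have "of_nat K * complex_of_real \<beta> = (\<Sum>i<T. (\<Sum>j<T. (of_nat K * a (int j - int i)) * v j) * cnj (b i))"
  proof -
    have "(\<Sum>j<T. (of_nat K * a (int j - int i)) * v j) = of_nat K * b i" for i
      by (simp add: b_def sum_distrib_left mult_ac)
    then show ?thesis
      unfolding \<beta>_def of_real_sum complex_norm_square by (simp add: sum_distrib_left mult_ac)
  qed
  also have "\<dots> = (\<Sum>i<T. (\<Sum>j<T. (\<Sum>l<K. p l * (c j l * cnj (c i l))) * v j) * cnj (b i))"
    unfolding p_def c_def
    using T K by (intro sum.cong refl arg_cong2[where f = "(*)"] toeplitz_entry_grid[symmetric]) auto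
  also have "\<dots> = (\<Sum>i<T. \<Sum>j<T. \<Sum>l<K. p l * ((c j l * v j) * cnj (c i l * b i)))"
    by (simp add: sum_distrib_left sum_distrib_right mult_ac)
  also have "\<dots> = (\<Sum>i<T. \<Sum>l<K. \<Sum>j<T. p l * ((c j l * v j) * cnj (c i l * b i)))"
    by (rule sum.cong[OF refl], rule sum.swap)
  also have "\<dots> = (\<Sum>l<K. \<Sum>i<T. \<Sum>j<T. p l * ((c j l * v j) * cnj (c i l * b i)))"
    by (rule sum.swap)
  also have "\<dots> = (\<Sum>l<K. p l * (hat v l * cnj (hat b l)))"
    unfolding hat_def cnj_sum sum_product
    by (intro sum.cong[OF refl], subst sum.swap) (simp add: sum_distrib_left)
  finally have eq: "of_nat K * complex_of_real \<beta> = (\<Sum>l<K. p l * (hat v l * cnj (hat b l)))" .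
  have \<beta>0: "\<beta> \<ge> 0" by (simp add: \<beta>_def sum_nonneg)
  have "real K * \<beta> = cmod (of_nat K * complex_of_real \<beta>)"
    using \<beta>0 by (simp add: norm_mult)
  also have "\<dots> \<le> (\<Sum>l<K. cmod (p l * (hat v l * cnj (hat b l))))"
    unfolding eq by (rule norm_sum)
  also have "\<dots> \<le> (\<Sum>l<K. P * (cmod (hat v l) * cmod (hat b l)))"
    using P by (intro sum_mono) (simp add: norm_mult p_def mult_right_mono)
  also have "\<dots> = P * (\<Sum>l<K. cmod (hat v l) * cmod (hat b l))"
    by (simp add: sum_distrib_left)
  finally have "(real K * \<beta>)\<^sup>2 \<le> (P * (\<Sum>l<K. cmod (hat v l) * cmod (hat b l)))\<^sup>2"
    using \<beta>0 by (intro power_mono) auto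
  also have "\<dots> = P\<^sup>2 * (\<Sum>l<K. cmod (hat v l) * cmod (hat b l))\<^sup>2"
    by (simp add: power_mult_distrib)
  also have "\<dots> \<le> P\<^sup>2 * ((\<Sum>l<K. (cmod (hat v l))\<^sup>2) * (\<Sum>l<K. (cmod (hat b l))\<^sup>2))"
    by (intro mult_left_mono Cauchy_Schwarz_ineq_sum) simp
  also have "\<dots> = (real K)\<^sup>2 * (P\<^sup>2 * (\<Sum>j<T. (cmod (v j))\<^sup>2) * \<beta>)"
    unfolding pars \<beta>_def by (simp add: power2_eq_square)
  finally have "(real K)\<^sup>2 * (\<beta> * \<beta>) \<le> (real K)\<^sup>2 * (P\<^sup>2 * (\<Sum>j<T. (cmod (v j))\<^sup>2) * \<beta>)"
    by (simp only: power_mult_distrib power2_eq_square[of \<beta>])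
  then have "\<beta> * \<beta> \<le> P\<^sup>2 * (\<Sum>j<T. (cmod (v j))\<^sup>2) * \<beta>"
    by (rule mult_left_le_imp_le) (use K in simp)
  then have "\<beta> \<le> P\<^sup>2 * (\<Sum>j<T. (cmod (v j))\<^sup>2)"
    using \<beta>0 by (cases "\<beta> = 0") (auto intro!: mult_nonneg_nonneg sum_nonneg)
  then show ?thesis by (simp add: \<beta>_def b_def)
qed

lemma spectral_norm_toeplitz_le:
  assumes T: "T \<le> L + 1" and K: "L + T \<le> K" "0 < K"
    and P: "\<And>l. l < K \<Longrightarrow> cmod (trig_poly L a (2 * pi * real l / real K)) \<le> P"
  shows "spectral_norm (toeplitz_mat a T) \<le> P"
  unfolding spectral_norm_def
proof (rule cSUP_least)
  have "0\<^sub>v T \<in> {v \<in> carrier_vec (dim_col (toeplitz_mat a T)). l2_norm_vec v \<le> 1}"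
    by (simp add: toeplitz_mat_def l2_norm_vec_def)
  then show "{v \<in> carrier_vec (dim_col (toeplitz_mat a T)). l2_norm_vec v \<le> 1} \<noteq> {}" by blast
next
  fix v assume "v \<in> {v \<in> carrier_vec (dim_col (toeplitz_mat a T)). l2_norm_vec v \<le> 1}"
  then have v: "v \<in> carrier_vec T" and v1: "(\<Sum>i<T. (cmod (vec_index v i))\<^sup>2) \<le> 1"
    by (auto simp: toeplitz_mat_def l2_norm_vec_def)
  have P0: "P \<ge> 0" using P[of 0] K norm_ge_zero order_trans by blast
  have idx: "vec_index (toeplitz_mat a T *\<^sub>v v) i = (\<Sum>j<T. a (int j - int i) * vec_index v j)" if "i < T" for i
    using that v by (auto simp: toeplitz_mat_def scalar_prod_def atLeast0LessThan)
  have "(\<Sum>i<T. (cmod (vec_index (toeplitz_mat a T *\<^sub>v v) i))\<^sup>2)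
      = (\<Sum>i<T. (cmod (\<Sum>j<T. a (int j - int i) * vec_index v j))\<^sup>2)"
    by (intro sum.cong refl) (simp add: idx)
  also have "\<dots> \<le> P\<^sup>2 * (\<Sum>j<T. (cmod (vec_index v j))\<^sup>2)"
    by (rule toeplitz_form_bound[OF assms])
  also have "\<dots> \<le> P\<^sup>2"
    using v1 by (simp add: mult_left_le)
  finally have "sqrt (\<Sum>i<T. (cmod (vec_index (toeplitz_mat a T *\<^sub>v v) i))\<^sup>2) \<le> P"
    using P0 by (simp add: real_le_lsqrt)
  then show "l2_norm_vec (toeplitz_mat a T *\<^sub>v v) \<le> P"
    by (simp add: l2_norm_vec_def toeplitz_mat_def)
qed

section \<open>The covariance matrix and the sup norm of its density\<close>

text \<open>Absolute summability bounds the range of the density, so that \<open>SUP\<close> is a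
  genuine upper bound.\<close>

lemma norm_spectral_density_le:
  assumes "(\<lambda>k. cmod (r k)) summable_on UNIV" and l: "0 \<le> l" "l < 2 * pi"
  shows "cmod (spectral_density r l) \<le> sup_norm_2pi (spectral_density r)"
  unfolding sup_norm_2pi_def
proof (rule cSUP_upper)
  have "cmod (spectral_density r l) \<le> (\<Sum>\<^sub>\<infinity>k. cmod (r k))" for l
  proof -
    have n: "cmod (r k * exp (- \<i> * of_int k * of_real l)) = cmod (r k)" for k
      by (simp add: norm_mult)
    have "cmod (spectral_density r l) \<le> (\<Sum>\<^sub>\<infinity>k. cmod (r k * exp (- \<i> * of_int k * of_real l)))"
      unfolding spectral_density_def by (rule norm_infsum_bound) (simp only: n assms)
    then show ?thesis by (simp only: n)
  qed
  then show "bdd_above ((\<lambda>l. cmod (spectral_density r l)) ` {0..<2 * pi})"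
    by (auto intro!: bdd_aboveI)
qed (use l in simp)

text \<open>The coefficients outside the window sum to at most \<epsilon> in modulus, uniformly in
  the frequency. The lower bound \<open>L0\<close> makes the window wide enough for the matrix size
  at hand.\<close>

lemma trig_poly_le_sup_norm:
  assumes r: "(\<lambda>k. cmod (r k)) summable_on UNIV" and \<epsilon>: "\<epsilon> > 0"
  obtains L where "L0 \<le> L" "\<And>l. 0 \<le> l \<Longrightarrow> l < 2 * pi \<Longrightarrow>
    cmod (trig_poly L r l) \<le> sup_norm_2pi (spectral_density r) + \<epsilon>"
proof -
  have "((\<lambda>k. cmod (r k)) has_sum (\<Sum>\<^sub>\<infinity>k. cmod (r k))) UNIV"
    using r by (rule has_sum_infsum)
  then have "\<forall>\<^sub>F X in finite_subsets_at_top UNIV. dist (\<Sum>k\<in>X. cmod (r k)) (\<Sum>\<^sub>\<infinity>k. cmod (r k)) < \<epsilon>"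
    unfolding has_sum_def using \<epsilon> by (rule tendstoD)
  then obtain X where X: "finite X"
    "\<And>Y. finite Y \<Longrightarrow> X \<subseteq> Y \<Longrightarrow> dist (\<Sum>k\<in>Y. cmod (r k)) (\<Sum>\<^sub>\<infinity>k. cmod (r k)) < \<epsilon>"
    by (auto simp: eventually_finite_subsets_at_top)
  \<comment> \<open>The sum of all \<open>\<bar>k\<bar>\<close> over \<open>X\<close> dominates each
    of them, so the window contains \<open>X\<close>.\<close>
  define L where "L = L0 + nat (\<Sum>k\<in>X. \<bar>k\<bar>)"
  define B where "B = {- int L..int L}"
  have "X \<subseteq> B"
  proof
    fix k assume "k \<in> X"
    then have "\<bar>k\<bar> \<le> (\<Sum>k\<in>X. \<bar>k\<bar>)"
      using X(1) by (intro member_le_sum) auto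
    then show "k \<in> B" by (auto simp: B_def L_def)
  qed
  then have d: "dist (\<Sum>k\<in>B. cmod (r k)) (\<Sum>\<^sub>\<infinity>k. cmod (r k)) < \<epsilon>"
    by (intro X(2)) (auto simp: B_def)
  have rB: "(\<lambda>k. cmod (r k)) summable_on (- B)"
    using r by (rule summable_on_subset_banach) simp
  have "(\<Sum>\<^sub>\<infinity>k. cmod (r k)) = (\<Sum>k\<in>B. cmod (r k)) + (\<Sum>\<^sub>\<infinity>k\<in>-B. cmod (r k))"
    using infsum_Un_disjoint[of "\<lambda>k. cmod (r k)" B "- B"] rB by (simp add: B_def)
  with d have tail: "(\<Sum>\<^sub>\<infinity>k\<in>-B. cmod (r k)) \<le> \<epsilon>"
    by (simp add: dist_real_def)
  have "cmod (trig_poly L r l) \<le> sup_norm_2pi (spectral_density r) + \<epsilon>" if l: "0 \<le> l" "l < 2 * pi" for l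
  proof -
    define f where "f k = r k * exp (- \<i> * of_int k * of_real l)" for k
    have n: "cmod (f k) = cmod (r k)" for k
      by (simp add: f_def norm_mult)
    have "f summable_on (- B)"
      by (rule abs_summable_summable) (simp only: n rB)
    then have "spectral_density r l = (\<Sum>k\<in>B. f k) + (\<Sum>\<^sub>\<infinity>k\<in>-B. f k)"
      unfolding spectral_density_def f_def[symmetric]
      using infsum_Un_disjoint[of f B "- B"] by (simp add: B_def)
    moreover have "(\<Sum>k\<in>B. f k) = trig_poly L r l"
      unfolding trig_poly_def B_def f_def cis_conv_exp by (simp add: mult_ac)
    ultimately have "trig_poly L r l = spectral_density r l - (\<Sum>\<^sub>\<infinity>k\<in>-B. f k)"
      by simp
    also have "cmod \<dots> \<le> cmod (spectral_density r l) + cmod (\<Sum>\<^sub>\<infinity>k\<in>-B. f k)"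
      by (rule norm_triangle_ineq4)
    also have "cmod (\<Sum>\<^sub>\<infinity>k\<in>-B. f k) \<le> (\<Sum>\<^sub>\<infinity>k\<in>-B. cmod (f k))"
      by (rule norm_infsum_bound) (simp only: n rB)
    also have "\<dots> \<le> \<epsilon>"
      using tail by (simp only: n)
    finally show ?thesis
      using norm_spectral_density_le[OF r l] by simp
  qed
  then show ?thesis
    by (intro that[of L]) (simp_all add: L_def)
qed

text \<open>A matrix of size \<open>T\<close> sees only lags below \<open>T\<close>, so it is also
  the Toeplitz matrix of any partial sum with \<open>L \<ge> T\<close>. Those partial sums exceed
  the sup norm by arbitrarily little, and the excess tends to 0.\<close>

lemma toeplitz_density_bound:
  assumes r: "(\<lambda>k. cmod (r k)) summable_on UNIV"
  shows "(\<Sum>i<T. (cmod (\<Sum>j<T. r (int j - int i) * v j))\<^sup>2)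
    \<le> (sup_norm_2pi (spectral_density r))\<^sup>2 * (\<Sum>j<T. (cmod (v j))\<^sup>2)"
proof -
  let ?A = "(\<Sum>i<T. (cmod (\<Sum>j<T. r (int j - int i) * v j))\<^sup>2)"
  let ?\<rho> = "sup_norm_2pi (spectral_density r)"
  let ?B = "(\<Sum>j<T. (cmod (v j))\<^sup>2)"
  have "?A \<le> (?\<rho> + inverse (real (Suc n)))\<^sup>2 * ?B" for n
  proof -
    obtain L where L: "T \<le> L" "\<And>l. 0 \<le> l \<Longrightarrow> l < 2 * pi \<Longrightarrow> cmod (trig_poly L r l) \<le> ?\<rho> + inverse (real (Suc n))"
      using trig_poly_le_sup_norm[OF r, of "inverse (real (Suc n))" T] by auto
    show ?thesis
    proof (rule toeplitz_form_bound)
      show "cmod (trig_poly L r (2 * pi * real l / real (L + T + 1))) \<le> ?\<rho> + inverse (real (Suc n))"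
        if "l < L + T + 1" for l
      proof (rule L)
        have "2 * pi * (real l / real (L + T + 1)) < 2 * pi * 1"
          using that by (intro mult_strict_left_mono) auto
        then show "2 * pi * real l / real (L + T + 1) < 2 * pi" by simp
      qed simp
    qed (use L in auto)
  qed
  moreover have "(\<lambda>n. (?\<rho> + inverse (real (Suc n)))\<^sup>2 * ?B) \<longlonglongrightarrow> (?\<rho> + 0)\<^sup>2 * ?B"
    by (intro tendsto_intros LIMSEQ_inverse_real_of_nat)
  ultimately show ?thesis
    by (intro LIMSEQ_le_const[of _ "?\<rho>\<^sup>2 * ?B"]) auto
qed

text \<open>The Toeplitz matrix of size 1 is \<open>r 0\<close>, so the density bound gives
  \<open>cmod (r 0)\<close> as a lower bound. Positivity allows the later divisions by the sup
  norm.\<close>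

lemma sup_norm_spectral_density_pos:
  assumes r: "(\<lambda>k. cmod (r k)) summable_on UNIV" and "r 0 \<noteq> 0"
  shows "0 < sup_norm_2pi (spectral_density r)"
proof -
  have "(cmod (r 0))\<^sup>2 \<le> (sup_norm_2pi (spectral_density r))\<^sup>2"
    using toeplitz_density_bound[OF r, where T = 1 and v = "\<lambda>_. 1"] by simp
  moreover have "0 \<le> sup_norm_2pi (spectral_density r)"
    by (rule order_trans[OF norm_ge_zero norm_spectral_density_le[OF r, of 0]]) simp_all
  ultimately show ?thesis
    using \<open>r 0 \<noteq> 0\<close> by (cases "sup_norm_2pi (spectral_density r) = 0") auto
qed

section \<open>The harmonic sum behind the logarithm\<close>

text \<open>A distance \<open>d > 0\<close> occurs for \<open>2 * (T - d)\<close> ordered pairs.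
  Distance 0 occurs \<open>T\<close> times but is counted twice on the right, hence the inequality
  and the need for \<open>f\<close> to be nonnegative.\<close>

lemma sum_square_abs_diff_le:
  fixes f :: "nat \<Rightarrow> real"
  assumes f: "\<And>d. 0 \<le> f d"
  shows "(\<Sum>s<T. \<Sum>t<T. f (nat \<bar>int s - int t\<bar>)) \<le> 2 * (\<Sum>d<T. real (T - d) * f d)"
proof (induction T)
  case (Suc T)
  have shift: "(\<Sum>t<T. f (nat \<bar>int T - int t\<bar>)) = (\<Sum>d<T. f (Suc d))"
  proof -
    have "(\<Sum>t<T. f (nat \<bar>int T - int t\<bar>)) = (\<Sum>t<T. f (Suc (T - Suc t)))"
      by (intro sum.cong refl arg_cong[where f = f]) auto
    then show ?thesis
      using sum.nat_diff_reindex[of "\<lambda>d. f (Suc d)" T] by simp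
  qed
  have shift': "(\<Sum>t<T. f (nat \<bar>int t - int T\<bar>)) = (\<Sum>d<T. f (Suc d))"
    unfolding shift[symmetric] by (simp only: abs_minus_commute)
  have "(\<Sum>s<Suc T. \<Sum>t<Suc T. f (nat \<bar>int s - int t\<bar>))
      = (\<Sum>s<T. \<Sum>t<T. f (nat \<bar>int s - int t\<bar>)) + (2 * (\<Sum>d<T. f (Suc d)) + f 0)"
    by (simp only: sum.lessThan_Suc sum.distrib shift shift') simp
  also have "\<dots> \<le> 2 * (\<Sum>d<T. real (T - d) * f d) + 2 * (\<Sum>d<Suc T. f d)"
    using Suc.IH f[of 0] by (simp add: sum.lessThan_Suc_shift del: sum.lessThan_Suc)
  also have "\<dots> = 2 * (\<Sum>d<Suc T. real (T - d) * f d + f d)"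
    by (simp add: sum.distrib)
  also have "(\<Sum>d<Suc T. real (T - d) * f d + f d) = (\<Sum>d<Suc T. real (Suc T - d) * f d)"
    by (intro sum.cong refl) (simp add: Suc_diff_le algebra_simps)
  finally show ?case .
qed simp

text \<open>The \<open>T - d\<close> pairs at distance \<open>d\<close> on one side contribute
  \<open>1 / (T - d)\<close> in total, and these terms form the harmonic sum in reverse
  order.\<close>

lemma sum_inverse_square_le:
  assumes "T \<ge> 1"
  shows "(\<Sum>s<T. \<Sum>t<T. 1 / (real T - \<bar>real s - real t\<bar>)\<^sup>2) \<le> 2 * (ln (real T) + 1)"
proof -
  have "(\<Sum>s<T. \<Sum>t<T. 1 / (real T - \<bar>real s - real t\<bar>)\<^sup>2)
      = (\<Sum>s<T. \<Sum>t<T. 1 / (real T - real (nat \<bar>int s - int t\<bar>))\<^sup>2)"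
    by (intro sum.cong refl) simp
  also have "\<dots> \<le> 2 * (\<Sum>d<T. real (T - d) * (1 / (real T - real d)\<^sup>2))"
    by (rule sum_square_abs_diff_le[of "\<lambda>d. 1 / (real T - real d)\<^sup>2"]) simp
  also have "(\<Sum>d<T. real (T - d) * (1 / (real T - real d)\<^sup>2)) = (\<Sum>d<T. inverse (real (Suc (T - Suc d))))"
    by (intro sum.cong refl) (simp add: of_nat_diff power2_eq_square divide_simps Suc_diff_Suc)
  also have "\<dots> = harm T"
    unfolding harm_altdef by (rule sum.nat_diff_reindex)
  \<comment> \<open>The difference of harmonic number and logarithm decreases from its first value
    1.\<close>
  also have "harm T \<le> ln (real T) + 1"
    using decseqD[OF decseq_harm_diff_ln, of 0 "T - 1"] assms by (simp add: harm_expand harm_def)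
  finally show ?thesis by simp
qed

section \<open>The unbiased covariance estimate\<close>

lemma sum_rotate:
  fixes f :: "nat \<Rightarrow> nat \<Rightarrow> nat \<Rightarrow> complex"
  shows "(\<Sum>a<l. \<Sum>b<m. \<Sum>c<n. f a b c) = (\<Sum>b<m. \<Sum>c<n. \<Sum>a<l. f a b c)"
proof -
  have "(\<Sum>a<l. \<Sum>b<m. \<Sum>c<n. f a b c) = (\<Sum>b<m. \<Sum>a<l. \<Sum>c<n. f a b c)"
    by (rule sum.swap)
  also have "\<dots> = (\<Sum>b<m. \<Sum>c<n. \<Sum>a<l. f a b c)"
    by (rule sum.cong[OF refl], rule sum.swap)
  finally show ?thesis .
qed

lemma sum_norm_square_combination:
  fixes x :: "nat \<Rightarrow> complex" and S :: "nat \<Rightarrow> nat \<Rightarrow> complex"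
  shows "(\<Sum>j<n. (\<Sum>t<n. x t * S j t) * cnj (\<Sum>t<n. x t * S j t))
       = (\<Sum>t<n. \<Sum>t'<n. x t * cnj (x t') * (\<Sum>j<n. S j t * cnj (S j t')))"
proof -
  have "(\<Sum>j<n. (\<Sum>t<n. x t * S j t) * cnj (\<Sum>t<n. x t * S j t))
      = (\<Sum>j<n. \<Sum>t<n. \<Sum>t'<n. x t * cnj (x t') * (S j t * cnj (S j t')))"
    unfolding cnj_sum sum_product by (simp add: mult_ac)
  also have "\<dots> = (\<Sum>t<n. \<Sum>t'<n. \<Sum>j<n. x t * cnj (x t') * (S j t * cnj (S j t')))"
    by (rule sum_rotate)
  finally show ?thesis by (simp only: sum_distrib_left)
qed

text \<open>With \<open>Q = S D S\<^sup>H\<close> and \<open>R = S\<^sup>H S\<close> the squared Frobenius norm of \<open>Q\<close> is the inner product of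
  \<open>R D\<close> and \<open>D R\<close>; Cauchy-Schwarz then only needs the operator norm of \<open>R\<close>.\<close>

lemma frobenius_congruence_le:
  fixes S D R :: "nat \<Rightarrow> nat \<Rightarrow> complex" and \<rho> :: real
  assumes R: "\<And>s t. s < n \<Longrightarrow> t < n \<Longrightarrow> (\<Sum>i<n. cnj (S i s) * S i t) = R s t"
    and op: "\<And>v. (\<Sum>s<n. (cmod (\<Sum>t<n. R s t * v t))\<^sup>2) \<le> \<rho>\<^sup>2 * (\<Sum>t<n. (cmod (v t))\<^sup>2)"
  defines "Q \<equiv> (\<lambda>i j. \<Sum>t<n. (\<Sum>s<n. D s t * S i s) * cnj (S j t))"
  shows "(\<Sum>i<n. \<Sum>j<n. (cmod (Q i j))\<^sup>2) \<le> \<rho>\<^sup>2 * (\<Sum>s<n. \<Sum>t<n. (cmod (D s t))\<^sup>2)"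
proof -
  define q where "q = (\<Sum>i<n. \<Sum>j<n. (cmod (Q i j))\<^sup>2)"
  define d where "d = (\<Sum>s<n. \<Sum>t<n. (cmod (D s t))\<^sup>2)"
  define E where "E i t = (\<Sum>s<n. D s t * S i s)" for i t
  define X where "X s' t = (\<Sum>s<n. R s' s * D s t)" for s' t
  \<comment> \<open>As \<open>R\<close> is Hermitian, this is the conjugate of the entry
    \<open>(s', t)\<close> of \<open>D R\<close>. With \<open>R\<close> on the left,
    \<open>op\<close> applies to the conjugated rows of \<open>D\<close>, just as it applies to the
    columns of \<open>D\<close> in \<open>X\<close>.\<close>
  define Y where "Y s' t = (\<Sum>t'<n. R t t' * cnj (D s' t'))" for s' t
  have EE: "(\<Sum>i<n. E i t * cnj (E i t')) = (\<Sum>s<n. \<Sum>s'<n. D s t * cnj (D s' t') * R s' s)"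
    if "t < n" "t' < n" for t t'
  proof -
    have "(\<Sum>i<n. E i t * cnj (E i t')) = (\<Sum>i<n. \<Sum>s<n. \<Sum>s'<n. D s t * cnj (D s' t') * (cnj (S i s') * S i s))"
      unfolding E_def cnj_sum sum_product by (simp add: mult_ac)
    also have "\<dots> = (\<Sum>s<n. \<Sum>s'<n. \<Sum>i<n. D s t * cnj (D s' t') * (cnj (S i s') * S i s))"
      by (rule sum_rotate)
    also have "\<dots> = (\<Sum>s<n. \<Sum>s'<n. D s t * cnj (D s' t') * R s' s)"
      by (simp add: sum_distrib_left[symmetric] R)
    finally show ?thesis .
  qed
  have "complex_of_real q = (\<Sum>i<n. \<Sum>j<n. (\<Sum>t<n. E i t * cnj (S j t)) * cnj (\<Sum>t<n. E i t * cnj (S j t)))"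
    unfolding q_def of_real_sum complex_norm_square Q_def E_def ..
  also have "\<dots> = (\<Sum>i<n. \<Sum>t<n. \<Sum>t'<n. E i t * cnj (E i t') * (\<Sum>j<n. cnj (S j t) * cnj (cnj (S j t'))))"
    by (simp only: sum_norm_square_combination)
  also have "\<dots> = (\<Sum>i<n. \<Sum>t<n. \<Sum>t'<n. E i t * cnj (E i t') * R t t')"
    by (intro sum.cong refl) (simp add: R)
  also have "\<dots> = (\<Sum>t<n. \<Sum>t'<n. \<Sum>i<n. E i t * cnj (E i t') * R t t')"
    by (rule sum_rotate)
  also have "\<dots> = (\<Sum>t<n. \<Sum>t'<n. (\<Sum>s<n. \<Sum>s'<n. D s t * cnj (D s' t') * R s' s) * R t t')"
    by (simp add: sum_distrib_right[symmetric] EE)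
  also have "\<dots> = (\<Sum>t<n. \<Sum>t'<n. \<Sum>s'<n. \<Sum>s<n. (R s' s * D s t) * (R t t' * cnj (D s' t')))"
    by (intro sum.cong refl, subst sum.swap) (simp add: sum_distrib_right sum_distrib_left mult_ac)
  also have "\<dots> = (\<Sum>t<n. \<Sum>s'<n. \<Sum>t'<n. \<Sum>s<n. (R s' s * D s t) * (R t t' * cnj (D s' t')))"
    by (rule sum.cong[OF refl], rule sum.swap)
  also have "\<dots> = (\<Sum>t<n. \<Sum>s'<n. X s' t * Y s' t)"
    unfolding X_def Y_def sum_product
    by (rule sum.cong[OF refl], rule sum.cong[OF refl], rule sum.swap)
  also have "\<dots> = (\<Sum>p\<in>{..<n} \<times> {..<n}. X (snd p) (fst p) * Y (snd p) (fst p))"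
    by (simp add: sum.cartesian_product split_def)
  finally have eq: "complex_of_real q = (\<Sum>p\<in>{..<n} \<times> {..<n}. X (snd p) (fst p) * Y (snd p) (fst p))" .
  have q0: "q \<ge> 0" and d0: "d \<ge> 0" by (auto simp: q_def d_def intro!: sum_nonneg)
  have "q = cmod (complex_of_real q)" using q0 by simp
  also have "\<dots> \<le> (\<Sum>p\<in>{..<n} \<times> {..<n}. cmod (X (snd p) (fst p)) * cmod (Y (snd p) (fst p)))"
    unfolding eq by (rule order_trans[OF norm_sum]) (simp add: norm_mult)
  finally have "q\<^sup>2 \<le> (\<Sum>p\<in>{..<n} \<times> {..<n}. cmod (X (snd p) (fst p)) * cmod (Y (snd p) (fst p)))\<^sup>2"
    using q0 by (intro power_mono)
  also have "\<dots> \<le> (\<Sum>p\<in>{..<n} \<times> {..<n}. (cmod (X (snd p) (fst p)))\<^sup>2) * (\<Sum>p\<in>{..<n} \<times> {..<n}. (cmod (Y (snd p) (fst p)))\<^sup>2)"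
    by (rule Cauchy_Schwarz_ineq_sum)
  also have "\<dots> \<le> (\<rho>\<^sup>2 * d) * (\<rho>\<^sup>2 * d)"
  proof (rule mult_mono)
    have "(\<Sum>p\<in>{..<n} \<times> {..<n}. (cmod (X (snd p) (fst p)))\<^sup>2) = (\<Sum>t<n. \<Sum>s'<n. (cmod (X s' t))\<^sup>2)"
      by (simp add: sum.cartesian_product split_def)
    also have "\<dots> \<le> (\<Sum>t<n. \<rho>\<^sup>2 * (\<Sum>s<n. (cmod (D s t))\<^sup>2))"
      unfolding X_def by (intro sum_mono op)
    also have "\<dots> = \<rho>\<^sup>2 * d"
      unfolding d_def sum_distrib_left by (rule sum.swap)
    finally show "(\<Sum>p\<in>{..<n} \<times> {..<n}. (cmod (X (snd p) (fst p)))\<^sup>2) \<le> \<rho>\<^sup>2 * d" .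
    have "(\<Sum>p\<in>{..<n} \<times> {..<n}. (cmod (Y (snd p) (fst p)))\<^sup>2) = (\<Sum>t<n. \<Sum>s'<n. (cmod (Y s' t))\<^sup>2)"
      by (simp add: sum.cartesian_product split_def)
    also have "\<dots> = (\<Sum>s'<n. \<Sum>t<n. (cmod (Y s' t))\<^sup>2)"
      by (rule sum.swap)
    also have "\<dots> \<le> (\<Sum>s'<n. \<rho>\<^sup>2 * (\<Sum>t'<n. (cmod (cnj (D s' t')))\<^sup>2))"
      unfolding Y_def by (intro sum_mono op)
    also have "\<dots> = \<rho>\<^sup>2 * d"
      by (simp add: d_def sum_distrib_left)
    finally show "(\<Sum>p\<in>{..<n} \<times> {..<n}. (cmod (Y (snd p) (fst p)))\<^sup>2) \<le> \<rho>\<^sup>2 * d" .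
  qed (use d0 in \<open>auto intro!: sum_nonneg mult_nonneg_nonneg\<close>)
  finally have "q\<^sup>2 \<le> (\<rho>\<^sup>2 * d)\<^sup>2" by (simp add: power2_eq_square)
  then have "q \<le> \<rho>\<^sup>2 * d"
    by (rule power2_le_imp_le) (simp add: d0)
  then show ?thesis by (simp add: q_def d_def)
qed

text \<open>The substitution \<open>s = t + k\<close>. It passes from the lag-wise definition of
  \<open>unbiased_autocov\<close>, whose guard is copied here, to a double sum that can be read as a
  quadratic form.\<close>

lemma sum_diagonals:
  fixes F :: "int \<Rightarrow> nat \<Rightarrow> nat \<Rightarrow> complex"
  assumes T: "1 \<le> T"
  shows "(\<Sum>k = - int (T - 1)..int (T - 1). \<Sum>t<T.
            if 0 \<le> int t + k \<and> int t + k \<le> int T - 1 then F k (nat (int t + k)) t else 0)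
       = (\<Sum>s<T. \<Sum>t<T. F (int s - int t) s t)"
proof -
  have "(\<Sum>k = - int (T - 1)..int (T - 1).
            if 0 \<le> int t + k \<and> int t + k \<le> int T - 1 then F k (nat (int t + k)) t else 0)
       = (\<Sum>s<T. F (int s - int t) s t)" if t: "t < T" for t
  proof -
    have "(\<Sum>k = - int (T - 1)..int (T - 1).
            if 0 \<le> int t + k \<and> int t + k \<le> int T - 1 then F k (nat (int t + k)) t else 0)
        = (\<Sum>k\<in>{k \<in> {- int (T - 1)..int (T - 1)}. 0 \<le> int t + k \<and> int t + k \<le> int T - 1}. F k (nat (int t + k)) t)"
      by (rule sum.inter_filter[symmetric]) simp
    also have "\<dots> = (\<Sum>s<T. F (int s - int t) s t)"
      by (rule sum.reindex_bij_witness[of _ "\<lambda>s. int s - int t" "\<lambda>k. nat (int t + k)"])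
        (use t T in auto)
    finally show ?thesis .
  qed
  then show ?thesis
    by (subst sum.swap) (simp, rule sum.swap)
qed

text \<open>This count is the factor that the unbiased normalisation cancels.\<close>

lemma diagonal_length:
  assumes T: "1 \<le> T" and k: "k \<in> {- int (T - 1)..int (T - 1)}"
  shows "(\<Sum>t<T. if 0 \<le> int t + k \<and> int t + k \<le> int T - 1 then c else 0)
       = (of_nat T - of_int \<bar>k\<bar>) * (c :: complex)"
proof -
  have "(\<Sum>t<T. if 0 \<le> int t + k \<and> int t + k \<le> int T - 1 then c else 0)
      = (\<Sum>t\<in>{t \<in> {..<T}. 0 \<le> int t + k \<and> int t + k \<le> int T - 1}. c)"
    by (rule sum.inter_filter[symmetric]) simp
  also have "{t \<in> {..<T}. 0 \<le> int t + k \<and> int t + k \<le> int T - 1} = {nat (- k)..<nat (int T - k)} \<inter> {..<T}"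
    using k by auto
  also have "\<dots> = {nat (- k)..<T - nat k}"
    using k T by auto
  also have "(\<Sum>t\<in>{nat (- k)..<T - nat k}. c) = of_nat (T - nat k - nat (- k)) * c"
    by simp
  also have "of_nat (T - nat k - nat (- k)) = (of_nat T - of_int \<bar>k\<bar> :: complex)"
  proof -
    have "int (T - nat k - nat (- k)) = int T - \<bar>k\<bar>"
      using k T by auto
    then have "(of_int (int (T - nat k - nat (- k))) :: complex) = of_int (int T - \<bar>k\<bar>)"
      by (rule arg_cong)
    then show ?thesis by simp
  qed
  finally show ?thesis .
qed

section \<open>The symbol of the estimate as a quadratic form\<close>

text \<open>The matrix \<open>D\<close> for which the symbol of the estimate at \<open>l\<close> is
  the average over the rows \<open>v\<close> of the form \<open>v D v^H\<close>: the phase comes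
  from the symbol, the denominator from the unbiased normalisation.\<close>

definition acov_weight :: "nat \<Rightarrow> real \<Rightarrow> nat \<Rightarrow> nat \<Rightarrow> complex" where
  "acov_weight T l s t = cis (- (of_int (int s - int t) * l)) / of_real (real T - \<bar>real s - real t\<bar>)"

lemma acov_weight_eq:
  "acov_weight T l s t = cis (- (of_int (int s - int t) * l)) / (of_nat T - of_int \<bar>int s - int t\<bar>)"
proof -
  have "\<bar>real s - real t\<bar> = of_int \<bar>int s - int t\<bar>" by simp
  then show ?thesis
    unfolding acov_weight_def by (simp only: of_real_diff of_real_of_nat_eq of_real_of_int_eq)
qed

lemma acov_weight_commute: "acov_weight T l t s = cnj (acov_weight T l s t)"
proof -
  have "- (of_int (int t - int s) * l) = - (- (of_int (int s - int t) * l))"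
    by (simp add: algebra_simps)
  then show ?thesis
    unfolding acov_weight_def complex_cnj_divide cis_cnj complex_cnj_complex_of_real
    by (simp only: abs_minus_commute)
qed

lemma norm_acov_weight: "(cmod (acov_weight T l s t))\<^sup>2 = 1 / (real T - \<bar>real s - real t\<bar>)\<^sup>2"
proof -
  have "cmod (acov_weight T l s t) = 1 / \<bar>real T - \<bar>real s - real t\<bar>\<bar>"
    unfolding acov_weight_def by (simp only: norm_divide norm_of_real norm_cis)
  then show ?thesis
    by (simp only: power_divide power_one power2_abs)
qed

text \<open>Unbiasedness: all terms on the \<open>k\<close>-th diagonal are equal, and their number
  cancels the denominator, so the expected form is the exact truncated symbol.\<close>

lemma trig_poly_weighted:
  assumes "1 \<le> T"
  shows "trig_poly (T - 1) r l = (\<Sum>s<T. \<Sum>t<T. acov_weight T l s t * r (int s - int t))"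
proof -
  let ?F = "\<lambda>k (s::nat) (t::nat). cis (- (of_int k * l)) / (of_nat T - of_int \<bar>k\<bar>) * r k"
  have "(\<Sum>s<T. \<Sum>t<T. acov_weight T l s t * r (int s - int t)) = (\<Sum>s<T. \<Sum>t<T. ?F (int s - int t) s t)"
    by (simp only: acov_weight_eq)
  also have "\<dots> = (\<Sum>k = - int (T - 1)..int (T - 1). \<Sum>t<T.
      if 0 \<le> int t + k \<and> int t + k \<le> int T - 1 then ?F k (nat (int t + k)) t else 0)"
    by (rule sum_diagonals[OF assms, symmetric])
  also have "\<dots> = (\<Sum>k = - int (T - 1)..int (T - 1). (of_nat T - of_int \<bar>k\<bar>) * ?F k 0 0)"
    by (intro sum.cong refl diagonal_length assms)
  also have "\<dots> = trig_poly (T - 1) r l"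
    unfolding trig_poly_def
  proof (intro sum.cong refl)
    fix k assume "k \<in> {- int (T - 1)..int (T - 1)}"
    then have "int T - \<bar>k\<bar> \<noteq> 0" using assms by auto
    then have "(of_int (int T - \<bar>k\<bar>) :: complex) \<noteq> 0" by (simp only: of_int_eq_0_iff not_False_eq_True)
    then have "(of_nat T - of_int \<bar>k\<bar> :: complex) \<noteq> 0" by simp
    then show "(of_nat T - of_int \<bar>k\<bar>) * ?F k 0 0 = r k * cis (- (of_int k * l))"
      by (simp del: of_int_abs)
  qed
  finally show ?thesis ..
qed

lemma trig_poly_unbiased_autocov:
  assumes V: "V \<in> carrier_mat N T" and T: "1 \<le> T"
  shows "trig_poly (T - 1) (unbiased_autocov V) l
    = (\<Sum>n<N. \<Sum>s<T. \<Sum>t<T. acov_weight T l s t * (V $$ (n, s) * cnj (V $$ (n, t)))) / of_nat N"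
proof -
  let ?F = "\<lambda>n k s t. cis (- (of_int k * l)) / (of_nat T - of_int \<bar>k\<bar>) * (V $$ (n, s) * cnj (V $$ (n, t)))"
  let ?c = "\<lambda>t k. 0 \<le> int t + k \<and> int t + k \<le> int T - 1"
  have dim: "dim_row V = N" "dim_col V = T" using V by auto
  have "trig_poly (T - 1) (unbiased_autocov V) l
      = (\<Sum>k = - int (T - 1)..int (T - 1). \<Sum>n<N. \<Sum>t<T. (if ?c t k then ?F n k (nat (int t + k)) t else 0) / of_nat N)"
    unfolding trig_poly_def
  proof (intro sum.cong refl)
    fix k
    let ?w = "cis (- (of_int k * l)) / (of_nat T - of_int \<bar>k\<bar>) / of_nat N"
    have "unbiased_autocov V k * cis (- (of_int k * l)) = ?w *
      (\<Sum>n<N. \<Sum>t<T. if ?c t k then V $$ (n, nat (int t + k)) * cnj (V $$ (n, t)) else 0)"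
      by (simp add: unbiased_autocov_def dim mult_ac)
    also have "\<dots> = (\<Sum>n<N. \<Sum>t<T. ?w * (if ?c t k then V $$ (n, nat (int t + k)) * cnj (V $$ (n, t)) else 0))"
      by (simp only: sum_distrib_left)
    also have "\<dots> = (\<Sum>n<N. \<Sum>t<T. (if ?c t k then ?F n k (nat (int t + k)) t else 0) / of_nat N)"
      by (intro sum.cong refl) simp
    finally show "unbiased_autocov V k * cis (- (of_int k * l))
      = (\<Sum>n<N. \<Sum>t<T. (if ?c t k then ?F n k (nat (int t + k)) t else 0) / of_nat N)" .
  qed
  also have "\<dots> = (\<Sum>n<N. \<Sum>k = - int (T - 1)..int (T - 1). \<Sum>t<T. if ?c t k then ?F n k (nat (int t + k)) t else 0) / of_nat N"
    by (subst sum.swap) (simp only: sum_divide_distrib)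
  also have "\<dots> = (\<Sum>n<N. \<Sum>s<T. \<Sum>t<T. ?F n (int s - int t) s t) / of_nat N"
  proof -
    have "(\<Sum>k = - int (T - 1)..int (T - 1). \<Sum>t<T. if ?c t k then ?F n k (nat (int t + k)) t else 0)
        = (\<Sum>s<T. \<Sum>t<T. ?F n (int s - int t) s t)" for n
      by (rule sum_diagonals[OF T, of "?F n"])
    then show ?thesis by (simp only:)
  qed
  finally show ?thesis by (simp only: acov_weight_eq)
qed

lemma index_mat_adjoint:
  assumes "A \<in> carrier_mat n m" "i < m" "j < n"
  shows "mat_adjoint A $$ (i, j) = cnj (A $$ (j, i))"
  using assms unfolding mat_adjoint_def mat_of_rows_def by (simp add: conjugate_complex_def)

lemma gram_toeplitz:
  assumes S: "S \<in> carrier_mat T T" and SS: "mat_adjoint S * S = toeplitz_mat r T" and "s < T" "t < T"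
  shows "(\<Sum>i<T. cnj (S $$ (i, s)) * S $$ (i, t)) = r (int t - int s)"
proof -
  have adj: "mat_adjoint S \<in> carrier_mat T T"
    using S by (auto simp: mat_adjoint_def)
  have "(mat_adjoint S * S) $$ (s, t) = (\<Sum>i<T. mat_adjoint S $$ (s, i) * S $$ (i, t))"
    using adj S assms(3,4) by (simp add: scalar_prod_def atLeast0LessThan)
  also have "\<dots> = (\<Sum>i<T. cnj (S $$ (i, s)) * S $$ (i, t))"
    using S assms(3,4) by (simp add: index_mat_adjoint[OF S])
  finally show ?thesis
    using assms(3,4) by (simp add: SS toeplitz_mat_def)
qed

text \<open>The matrix \<open>S D S^H\<close>: a row \<open>v = w S\<close> turns
  \<open>v D v^H\<close> into the form of this matrix in \<open>w\<close>. It is spelled out in the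
  shape of \<open>Q\<close> in \<open>frobenius_congruence_le\<close>.\<close>

definition congruence :: "nat \<Rightarrow> complex mat \<Rightarrow> (nat \<Rightarrow> nat \<Rightarrow> complex) \<Rightarrow> nat \<Rightarrow> nat \<Rightarrow> complex" where
  "congruence n S D i j = (\<Sum>t<n. (\<Sum>s<n. D s t * S $$ (i, s)) * cnj (S $$ (j, t)))"

lemma congruence_hermitian:
  assumes "\<And>s t. D t s = cnj (D s t)"
  shows "congruence n S D j i = cnj (congruence n S D i j)"
proof -
  have "cnj (congruence n S D i j) = (\<Sum>t<n. \<Sum>s<n. D t s * S $$ (j, t) * cnj (S $$ (i, s)))"
    unfolding congruence_def cnj_sum complex_cnj_mult sum_distrib_right
    by (simp add: assms[symmetric] mult_ac)
  also have "\<dots> = congruence n S D j i"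
    unfolding congruence_def sum_distrib_right by (rule sum.swap)
  finally show ?thesis ..
qed

lemma quadratic_form_congruence:
  "(\<Sum>s<n. \<Sum>t<n. D s t * ((\<Sum>i<n. w i * S $$ (i, s)) * cnj (\<Sum>i<n. w i * S $$ (i, t))))
    = (\<Sum>i<n. \<Sum>j<n. w i * cnj (w j) * congruence n S D i j)"
proof -
  let ?f = "\<lambda>i j s t. w i * cnj (w j) * (D s t * S $$ (i, s) * cnj (S $$ (j, t)))"
  have "(\<Sum>s<n. \<Sum>t<n. D s t * ((\<Sum>i<n. w i * S $$ (i, s)) * cnj (\<Sum>i<n. w i * S $$ (i, t))))
      = (\<Sum>s<n. \<Sum>t<n. \<Sum>i<n. \<Sum>j<n. ?f i j s t)"
    unfolding cnj_sum sum_product unfolding sum_distrib_left by (simp add: mult_ac)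
  also have "\<dots> = (\<Sum>t<n. \<Sum>i<n. \<Sum>s<n. \<Sum>j<n. ?f i j s t)"
    by (rule sum_rotate)
  also have "\<dots> = (\<Sum>t<n. \<Sum>i<n. \<Sum>j<n. \<Sum>s<n. ?f i j s t)"
    by (rule sum.cong[OF refl], rule sum.cong[OF refl], rule sum.swap)
  also have "\<dots> = (\<Sum>i<n. \<Sum>j<n. \<Sum>t<n. \<Sum>s<n. ?f i j s t)"
    by (rule sum_rotate)
  also have "\<dots> = (\<Sum>i<n. \<Sum>j<n. w i * cnj (w j) * congruence n S D i j)"
    unfolding congruence_def by (simp only: sum_distrib_left sum_distrib_right)
  finally show ?thesis .
qed

text \<open>By cyclicity the trace is that of \<open>D S^H S\<close>, so it depends on the
  covariance and not on the choice of the root \<open>S\<close>.\<close>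

lemma trace_congruence:
  assumes S: "S \<in> carrier_mat T T" and SS: "mat_adjoint S * S = toeplitz_mat r T"
  shows "(\<Sum>i<T. congruence T S D i i) = (\<Sum>s<T. \<Sum>t<T. D s t * r (int s - int t))"
proof -
  have "(\<Sum>i<T. congruence T S D i i) = (\<Sum>i<T. \<Sum>t<T. \<Sum>s<T. D s t * (cnj (S $$ (i, t)) * S $$ (i, s)))"
    unfolding congruence_def sum_distrib_right by (simp add: mult_ac)
  also have "\<dots> = (\<Sum>t<T. \<Sum>s<T. \<Sum>i<T. D s t * (cnj (S $$ (i, t)) * S $$ (i, s)))"
    by (rule sum_rotate)
  also have "\<dots> = (\<Sum>t<T. \<Sum>s<T. D s t * r (int s - int t))"
    by (simp add: sum_distrib_left[symmetric] gram_toeplitz[OF S SS])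
  also have "\<dots> = (\<Sum>s<T. \<Sum>t<T. D s t * r (int s - int t))"
    by (rule sum.swap)
  finally show ?thesis .
qed

text \<open>The bridge between the Toeplitz and the Gaussian half: the subtracted trace is the true
  symbol, and the Hermitian weights make form and trace real, so that one-sided tail bounds for
  \<plusminus>\<open>Q\<close> control the complex modulus.\<close>

lemma trig_poly_estimation_error:
  fixes l :: real
  assumes W: "W \<in> carrier_mat N T" and S: "S \<in> carrier_mat T T"
    and SS: "mat_adjoint S * S = toeplitz_mat r T" and T: "1 \<le> T" and N: "1 \<le> N"
  defines "Q \<equiv> congruence T S (acov_weight T l)"
  shows "of_nat N * trig_poly (T - 1) (\<lambda>k. unbiased_autocov (W * S) k - r k) l
    = of_real ((\<Sum>n<N. Re (\<Sum>i<T. \<Sum>j<T. W $$ (n, i) * cnj (W $$ (n, j)) * Q i j)) - real N * Re (\<Sum>i<T. Q i i))"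
proof -
  have herm: "Q j i = cnj (Q i j)" for i j
    unfolding Q_def by (intro congruence_hermitian acov_weight_commute)
  have real: "z = of_real (Re z)" if "cnj z = z" for z
    using that by (simp add: complex_eq_iff)
  have real_form: "(\<Sum>i<T. \<Sum>j<T. w i * cnj (w j) * Q i j) = of_real (Re (\<Sum>i<T. \<Sum>j<T. w i * cnj (w j) * Q i j))" for w
  proof -
    have "cnj (\<Sum>i<T. \<Sum>j<T. w i * cnj (w j) * Q i j) = (\<Sum>i<T. \<Sum>j<T. w i * cnj (w j) * Q i j)"
      using hermitian_form_real[of T Q "\<lambda>i. cnj (w i)", OF herm] by (simp only: complex_cnj_cnj mult_ac)
    then show ?thesis by (rule real)
  qed
  have "Q i i = of_real (Re (Q i i))" for i
    using herm[of i i] by (intro real) simp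
  then have real_trace: "(\<Sum>i<T. Q i i) = of_real (Re (\<Sum>i<T. Q i i))"
    unfolding Re_sum of_real_sum by simp
  have V: "W * S \<in> carrier_mat N T" using W S by simp
  have VW: "(W * S) $$ (n, s) = (\<Sum>i<T. W $$ (n, i) * S $$ (i, s))" if "n < N" "s < T" for n s
    using that W S by (simp add: scalar_prod_def atLeast0LessThan)
  have "of_nat N * trig_poly (T - 1) (unbiased_autocov (W * S)) l
      = (\<Sum>n<N. \<Sum>s<T. \<Sum>t<T. acov_weight T l s t * ((W * S) $$ (n, s) * cnj ((W * S) $$ (n, t))))"
    using N unfolding trig_poly_unbiased_autocov[OF V T] by simp
  also have "\<dots> = (\<Sum>n<N. \<Sum>i<T. \<Sum>j<T. W $$ (n, i) * cnj (W $$ (n, j)) * Q i j)"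
    unfolding Q_def quadratic_form_congruence[symmetric] by (intro sum.cong refl) (simp add: VW)
  finally have est: "of_nat N * trig_poly (T - 1) (unbiased_autocov (W * S)) l
      = (\<Sum>n<N. \<Sum>i<T. \<Sum>j<T. W $$ (n, i) * cnj (W $$ (n, j)) * Q i j)" .
  have mean: "trig_poly (T - 1) r l = (\<Sum>i<T. Q i i)"
    unfolding Q_def trace_congruence[OF S SS] trig_poly_weighted[OF T] ..
  have "trig_poly (T - 1) (\<lambda>k. unbiased_autocov (W * S) k - r k) l
      = trig_poly (T - 1) (unbiased_autocov (W * S)) l - trig_poly (T - 1) r l"
    unfolding trig_poly_def by (simp only: left_diff_distrib sum_subtractf)
  then have "of_nat N * trig_poly (T - 1) (\<lambda>k. unbiased_autocov (W * S) k - r k) l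
      = (\<Sum>n<N. \<Sum>i<T. \<Sum>j<T. W $$ (n, i) * cnj (W $$ (n, j)) * Q i j) - of_nat N * (\<Sum>i<T. Q i i)"
    by (simp only: right_diff_distrib est mean)
  also have "\<dots> = (\<Sum>n<N. of_real (Re (\<Sum>i<T. \<Sum>j<T. W $$ (n, i) * cnj (W $$ (n, j)) * Q i j)))
      - of_nat N * of_real (Re (\<Sum>i<T. Q i i))"
    unfolding real_form[symmetric] real_trace[symmetric] ..
  finally show ?thesis by simp
qed

section \<open>Union bound and asymptotics of the exponent\<close>

lemma estimation_error_tail:
  assumes r: "(\<lambda>k. cmod (r k)) summable_on UNIV"
    and "prob_space M" and W: "iid_complex_gaussian_mat M N T W"
    and S: "S \<in> carrier_mat T T" and SS: "mat_adjoint S * S = toeplitz_mat r T"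
    and T: "1 \<le> T" and N: "1 \<le> N"
    and F: "F\<^sup>2 = (sup_norm_2pi (spectral_density r))\<^sup>2 * (2 * (ln (real T) + 1))"
    and x: "0 < x" "x < F"
  shows "measure M {\<omega> \<in> space M. spectral_norm (unbiased_cov_estimate (W \<omega> * S) - toeplitz_mat r T) > x}
    \<le> 4 * real T * exp (- (real N * x\<^sup>2 / (2 * F\<^sup>2) * (2 - 1 / (1 - x / F))))"
proof -
  interpret prob_space M by fact
  define g where "g l = 2 * pi * real l / real (2 * T)" for l :: nat
  \<comment> \<open>The sign \<open>sg\<close> is 1 or -1 and turns the two-sided deviation into two
    upper tails.\<close>
  define Q where "Q sg l i j = of_real sg * congruence T S (acov_weight T (g l)) i j" for sg l i j
  define E where "E sg l = {\<omega> \<in> space M. real N * x \<le>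
      (\<Sum>n<N. Re (\<Sum>i<T. \<Sum>j<T. W \<omega> $$ (n, i) * cnj (W \<omega> $$ (n, j)) * Q sg l i j)) - real N * Re (\<Sum>i<T. Q sg l i i)}" for sg l
  let ?b = "exp (- (real N * x\<^sup>2 / (2 * F\<^sup>2) * (2 - 1 / (1 - x / F))))"
  have tail: "E sg l \<in> sets M \<and> measure M (E sg l) \<le> ?b" if sg: "sg\<^sup>2 = 1" for sg l
  proof -
    have herm: "Q sg l j i = cnj (Q sg l i j)" for i j
      using congruence_hermitian[of "acov_weight T (g l)" T S j i, OF acov_weight_commute]
      by (simp add: Q_def)
    have "(\<Sum>i<T. \<Sum>j<T. (cmod (Q sg l i j))\<^sup>2) = (\<Sum>i<T. \<Sum>j<T. (cmod (congruence T S (acov_weight T (g l)) i j))\<^sup>2)"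
      using sg by (simp add: Q_def norm_mult power_mult_distrib)
    also have "\<dots> \<le> (sup_norm_2pi (spectral_density r))\<^sup>2 * (\<Sum>s<T. \<Sum>t<T. (cmod (acov_weight T (g l) s t))\<^sup>2)"
      unfolding congruence_def
      by (rule frobenius_congruence_le[where R = "\<lambda>s t. r (int t - int s)"])
        (use gram_toeplitz[OF S SS] toeplitz_density_bound[OF r] in auto)
    also have "\<dots> \<le> (sup_norm_2pi (spectral_density r))\<^sup>2 * (2 * (ln (real T) + 1))"
      unfolding norm_acov_weight by (intro mult_left_mono sum_inverse_square_le T) simp
    finally have fro: "(\<Sum>i<T. \<Sum>j<T. (cmod (Q sg l i j))\<^sup>2) \<le> F\<^sup>2"
      by (simp only: F)
    show ?thesis
      using gaussian_quadratic_form_tail[of M N T W "Q sg l" F x, OF assms(2) W herm fro x]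
      unfolding E_def by blast
  qed
  have mE [measurable]: "E 1 l \<in> sets M" "E (- 1) l \<in> sets M" for l
    using tail[of 1 l] tail[of "- 1" l] by auto
  let ?U = "\<Union>l<2 * T. E 1 l \<union> E (- 1) l"
  \<comment> \<open>Outside the union every grid value of the error symbol is at most
    \<open>x\<close>, hence so is the spectral norm. Monotonicity then rests on the measurability of
    the union alone.\<close>
  have "{\<omega> \<in> space M. spectral_norm (unbiased_cov_estimate (W \<omega> * S) - toeplitz_mat r T) > x} \<subseteq> ?U"
  proof (rule subsetI, rule ccontr)
    fix \<omega> assume "\<omega> \<in> {\<omega> \<in> space M. spectral_norm (unbiased_cov_estimate (W \<omega> * S) - toeplitz_mat r T) > x}"
    then have \<omega>: "\<omega> \<in> space M" and big: "spectral_norm (unbiased_cov_estimate (W \<omega> * S) - toeplitz_mat r T) > x"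
      by auto
    assume notin: "\<omega> \<notin> ?U"
    have W\<omega>: "W \<omega> \<in> carrier_mat N T"
      using W \<omega> by (simp add: iid_complex_gaussian_mat_def)
    define a where "a k = unbiased_autocov (W \<omega> * S) k - r k" for k
    have "cmod (trig_poly (T - 1) a (g l)) \<le> x" if l: "l < 2 * T" for l
    proof -
      define e where "e = (\<Sum>n<N. Re (\<Sum>i<T. \<Sum>j<T. W \<omega> $$ (n, i) * cnj (W \<omega> $$ (n, j)) * congruence T S (acov_weight T (g l)) i j))
          - real N * Re (\<Sum>i<T. congruence T S (acov_weight T (g l)) i i)"
      have "\<omega> \<notin> E 1 l" "\<omega> \<notin> E (- 1) l"
        using notin l by auto
      then have "e < real N * x" "- e < real N * x"
        using \<omega> by (auto simp: E_def Q_def e_def sum_negf not_le)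
      then have e: "\<bar>e\<bar> \<le> real N * x" by linarith
      have "of_nat N * trig_poly (T - 1) a (g l) = of_real e"
        unfolding a_def e_def by (rule trig_poly_estimation_error[OF W\<omega> S SS T N])
      then have "real N * cmod (trig_poly (T - 1) a (g l)) = \<bar>e\<bar>"
        by (metis norm_mult norm_of_nat norm_of_real)
      with e have "real N * cmod (trig_poly (T - 1) a (g l)) \<le> real N * x" by simp
      then show ?thesis using N by simp
    qed
    then have "spectral_norm (toeplitz_mat a T) \<le> x"
      using T unfolding g_def by (intro spectral_norm_toeplitz_le[of T "T - 1" "2 * T"]) auto
    moreover have "unbiased_cov_estimate (W \<omega> * S) - toeplitz_mat r T = toeplitz_mat a T"
      using W\<omega> S by (intro eq_matI) (auto simp: unbiased_cov_estimate_def toeplitz_mat_def a_def)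
    ultimately show False using big by simp
  qed
  then have "measure M {\<omega> \<in> space M. spectral_norm (unbiased_cov_estimate (W \<omega> * S) - toeplitz_mat r T) > x} \<le> measure M ?U"
    by (intro finite_measure_mono) measurable
  also have "\<dots> \<le> (\<Sum>l<2 * T. measure M (E 1 l \<union> E (- 1) l))"
    by (intro finite_measure_subadditive_finite) (auto intro: mE)
  also have "\<dots> \<le> (\<Sum>l<2 * T. ?b + ?b)"
  proof (rule sum_mono)
    fix l
    have "measure M (E 1 l \<union> E (- 1) l) \<le> measure M (E 1 l) + measure M (E (- 1) l)"
      by (intro measure_Un_le mE)
    then show "measure M (E 1 l \<union> E (- 1) l) \<le> ?b + ?b"
      using tail[of 1 l] tail[of "- 1" l] by simp
  qed
  also have "\<dots> = 4 * real T * ?b" by simp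
  finally show ?thesis .
qed

text \<open>The quotient is a product of \<open>N / (c T)\<close>, \<open>ln T / (ln T + 1)\<close>
  and the Chernoff correction, all tending to 1, minus a multiple of
  \<open>ln (4 T) * ln T / T\<close>, the relative cost of the union bound.\<close>

lemma ratio_of_exponents_tendsto:
  fixes N :: "nat \<Rightarrow> nat" and c x \<rho> :: real
  assumes N: "(\<lambda>T. real (N T) / real T) \<longlonglongrightarrow> c" and c: "0 < c" and x: "0 < x" and \<rho>: "0 < \<rho>"
  defines "F \<equiv> (\<lambda>T. \<rho> * sqrt (2 * (ln (real T) + 1)))"
  shows "(\<lambda>T. (real (N T) * x\<^sup>2 / (2 * (F T)\<^sup>2) * (2 - 1 / (1 - x / F T)) - ln (4 * real T))
    / (c * real T * x\<^sup>2 / (4 * \<rho>\<^sup>2 * ln (real T)))) \<longlonglongrightarrow> 1"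
proof -
  have "(\<lambda>T. (x / \<rho>) * (1 / sqrt (2 * (ln (real T) + 1)))) \<longlonglongrightarrow> (x / \<rho>) * 0"
    by (intro tendsto_mult tendsto_const) real_asymp
  then have y: "(\<lambda>T. x / F T) \<longlonglongrightarrow> 0"
    by (simp add: F_def)
  have "(\<lambda>T. real (N T) / real T / c * (ln (real T) / (ln (real T) + 1)) * (2 - 1 / (1 - x / F T))
      - 4 * \<rho>\<^sup>2 / (c * x\<^sup>2) * (ln (4 * real T) * ln (real T) / real T)) \<longlonglongrightarrow>
      c / c * 1 * (2 - 1 / (1 - 0)) - 4 * \<rho>\<^sup>2 / (c * x\<^sup>2) * 0"
  proof (intro tendsto_intros N y)
    show "(\<lambda>T. ln (real T) / (ln (real T) + 1)) \<longlonglongrightarrow> 1" by real_asymp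
    show "(\<lambda>T. ln (4 * real T) * ln (real T) / real T) \<longlonglongrightarrow> 0" by real_asymp
  qed (use c in auto)
  then have "(\<lambda>T. real (N T) / real T / c * (ln (real T) / (ln (real T) + 1)) * (2 - 1 / (1 - x / F T))
      - 4 * \<rho>\<^sup>2 / (c * x\<^sup>2) * (ln (4 * real T) * ln (real T) / real T)) \<longlonglongrightarrow> 1"
    using c by simp
  moreover have "eventually (\<lambda>T. real (N T) / real T / c * (ln (real T) / (ln (real T) + 1)) * (2 - 1 / (1 - x / F T))
      - 4 * \<rho>\<^sup>2 / (c * x\<^sup>2) * (ln (4 * real T) * ln (real T) / real T)
      = (real (N T) * x\<^sup>2 / (2 * (F T)\<^sup>2) * (2 - 1 / (1 - x / F T)) - ln (4 * real T))
    / (c * real T * x\<^sup>2 / (4 * \<rho>\<^sup>2 * ln (real T)))) sequentially"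
    using eventually_ge_at_top[of 2]
  proof eventually_elim
    fix T :: nat assume T: "2 \<le> T"
    define L where "L = ln (real T)"
    define h where "h = 2 - 1 / (1 - x / F T)"
    define k where "k = ln (4 * real T)"
    have L: "L > 0" using T by (simp add: L_def)
    have F2: "(F T)\<^sup>2 = \<rho>\<^sup>2 * (2 * (L + 1))"
      using L by (simp add: F_def L_def power_mult_distrib)
    have "real (N T) / real T / c * (L / (L + 1)) * h - 4 * \<rho>\<^sup>2 / (c * x\<^sup>2) * (k * L / real T)
        = (real (N T) * x\<^sup>2 / (2 * (F T)\<^sup>2) * h - k) / (c * real T * x\<^sup>2 / (4 * \<rho>\<^sup>2 * L))"
    proof -
      define A where "A = c * real T * x\<^sup>2 / (4 * \<rho>\<^sup>2 * L)"
      have A: "A \<noteq> 0" using L T c x \<rho> by (simp add: A_def)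
      define P where "P = real (N T) / real T / c * (L / (L + 1))"
      define K where "K = 4 * \<rho>\<^sup>2 / (c * x\<^sup>2) * (k * L / real T)"
      have "P * A = real (N T) * x\<^sup>2 / (2 * (F T)\<^sup>2)"
        using L T c x \<rho> by (simp add: A_def P_def F2 divide_simps)
      moreover have "K * A = k"
        using L T c x \<rho> by (simp add: A_def K_def divide_simps)
      moreover have "(P * h - K) * A = P * A * h - K * A"
        by (simp add: algebra_simps)
      ultimately have "real (N T) * x\<^sup>2 / (2 * (F T)\<^sup>2) * h - k = (P * h - K) * A"
        by simp
      then show ?thesis
        using A unfolding A_def[symmetric] P_def[symmetric] K_def[symmetric] by simp
    qed
    then show "real (N T) / real T / c * (ln (real T) / (ln (real T) + 1)) * (2 - 1 / (1 - x / F T))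
      - 4 * \<rho>\<^sup>2 / (c * x\<^sup>2) * (ln (4 * real T) * ln (real T) / real T)
      = (real (N T) * x\<^sup>2 / (2 * (F T)\<^sup>2) * (2 - 1 / (1 - x / F T)) - ln (4 * real T))
    / (c * real T * x\<^sup>2 / (4 * \<rho>\<^sup>2 * ln (real T)))"
      by (simp only: L_def h_def k_def)
  qed
  ultimately show ?thesis
    by (rule Lim_transform_eventually)
qed

theorem theorem2:
  fixes r :: "int \<Rightarrow> complex"
    and N :: "nat \<Rightarrow> nat"
    and c x :: real
    and M :: "'a measure"
    and W :: "nat \<Rightarrow> 'a \<Rightarrow> complex mat"
    and S :: "nat \<Rightarrow> complex mat"
    and V :: "nat \<Rightarrow> 'a \<Rightarrow> complex mat"
  assumes "covariance_coeffs r"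
    and "(\<lambda>k. cmod (r k)) summable_on UNIV"
    and "r 0 \<noteq> 0"
    and "\<And>T. T \<ge> 1 \<Longrightarrow> N T \<ge> 1"
    and "(\<lambda>T. real (N T) / real T) \<longlonglongrightarrow> c"
    and "0 < c"
    and "prob_space M"
    and "\<And>T. T \<ge> 1 \<Longrightarrow> iid_complex_gaussian_mat M (N T) T (W T)"
    and "\<And>T. T \<ge> 1 \<Longrightarrow> S T \<in> carrier_mat T T"
    and "\<And>T. T \<ge> 1 \<Longrightarrow> mat_adjoint (S T) * S T = toeplitz_mat r T"
    and "\<And>T \<omega>. T \<ge> 1 \<Longrightarrow> \<omega> \<in> space M \<Longrightarrow> V T \<omega> = W T \<omega> * S T"
    and "x > 0"
  shows "\<exists>\<epsilon> :: nat \<Rightarrow> real. \<epsilon> \<longlonglongrightarrow> 0 \<and>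
    (\<forall>T\<ge>2. measure M {\<omega> \<in> space M.
              spectral_norm (unbiased_cov_estimate (V T \<omega>) - toeplitz_mat r T) > x}
       \<le> exp (- (c * real T * x\<^sup>2 /
                 (4 * (sup_norm_2pi (spectral_density r))\<^sup>2 * ln (real T))) * (1 + \<epsilon> T)))"
proof -
  interpret prob_space M by fact
  define \<rho> where "\<rho> = sup_norm_2pi (spectral_density r)"
  have \<rho>: "\<rho> > 0"
    unfolding \<rho>_def using assms(2,3) by (rule sup_norm_spectral_density_pos)
  define F where "F T = \<rho> * sqrt (2 * (ln (real T) + 1))" for T :: nat
  define A where "A T = c * real T * x\<^sup>2 / (4 * \<rho>\<^sup>2 * ln (real T))" for T :: nat
  define B where "B T = real (N T) * x\<^sup>2 / (2 * (F T)\<^sup>2) * (2 - 1 / (1 - x / F T)) - ln (4 * real T)" for T :: nat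
  \<comment> \<open>Where \<open>x < F T\<close>, this choice makes
    \<open>A T * (1 + \<epsilon> T)\<close> equal to \<open>B T\<close>. Elsewhere the value -1
    turns the claim into the trivial bound by 1; that happens for finitely many \<open>T\<close>
    because \<open>F\<close> tends to infinity.\<close>
  define \<epsilon> where "\<epsilon> T = (if x < F T then B T / A T - 1 else - 1)" for T
  have "(\<lambda>T. B T / A T) \<longlonglongrightarrow> 1"
    unfolding B_def A_def F_def using assms(5,6,12) \<rho> by (rule ratio_of_exponents_tendsto)
  then have "(\<lambda>T. B T / A T - 1) \<longlonglongrightarrow> 1 - 1"
    by (intro tendsto_intros)
  moreover have "eventually (\<lambda>T. B T / A T - 1 = \<epsilon> T) sequentially"
  proof -
    have "filterlim F at_top sequentially"
      unfolding F_def using \<rho> by real_asymp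
    then have "eventually (\<lambda>T. x < F T) sequentially"
      by (simp add: filterlim_at_top_dense)
    then show ?thesis
      by eventually_elim (simp add: \<epsilon>_def)
  qed
  ultimately have "\<epsilon> \<longlonglongrightarrow> 1 - 1"
    by (rule Lim_transform_eventually)
  moreover have "measure M {\<omega> \<in> space M. spectral_norm (unbiased_cov_estimate (V T \<omega>) - toeplitz_mat r T) > x}
      \<le> exp (- A T * (1 + \<epsilon> T))" if T: "2 \<le> T" for T
  proof (cases "x < F T")
    case True
    have T1: "1 \<le> T" using T by simp
    \<comment> \<open>At \<open>T = 1\<close> the logarithm vanishes; \<open>T \<ge> 2\<close> makes
      the division in \<epsilon> legitimate.\<close>
    have A: "A T > 0" using T assms(6,12) \<rho> by (simp add: A_def)
    have "{\<omega> \<in> space M. spectral_norm (unbiased_cov_estimate (V T \<omega>) - toeplitz_mat r T) > x}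
        = {\<omega> \<in> space M. spectral_norm (unbiased_cov_estimate (W T \<omega> * S T) - toeplitz_mat r T) > x}"
      using assms(11)[OF T1] by auto
    then have "measure M {\<omega> \<in> space M. spectral_norm (unbiased_cov_estimate (V T \<omega>) - toeplitz_mat r T) > x}
        = measure M {\<omega> \<in> space M. spectral_norm (unbiased_cov_estimate (W T \<omega> * S T) - toeplitz_mat r T) > x}"
      by (rule arg_cong)
    also have "\<dots> \<le> 4 * real T * exp (- (real (N T) * x\<^sup>2 / (2 * (F T)\<^sup>2) * (2 - 1 / (1 - x / F T))))"
    proof (rule estimation_error_tail)
      show "(F T)\<^sup>2 = (sup_norm_2pi (spectral_density r))\<^sup>2 * (2 * (ln (real T) + 1))"
        using T1 by (simp add: F_def \<rho>_def power_mult_distrib add_nonneg_nonneg)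
    qed (use assms(2,7,12) assms(4,8-10)[OF T1] T1 True in auto)
    also have "\<dots> = exp (ln (4 * real T)) * exp (- (real (N T) * x\<^sup>2 / (2 * (F T)\<^sup>2) * (2 - 1 / (1 - x / F T))))"
      using T by simp
    also have "\<dots> = exp (- B T)"
      by (simp only: exp_add[symmetric] B_def) simp
    also have "\<dots> = exp (- A T * (1 + \<epsilon> T))"
      using A True by (simp add: \<epsilon>_def)
    finally show ?thesis .
  qed (simp add: \<epsilon>_def)
  ultimately show ?thesis
    by (intro exI[of _ \<epsilon>]) (simp add: A_def \<rho>_def)
qed

end
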